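(* Let $T$ be any fractional lower bound operator. Then for any $m\times m$ matrix $A_{p,q}$ weights $U,V$ and any locally integrable $m\times m$ matrix-valued symbol $B$, $$\|B\|_{\widetilde{\mathrm{BMO}}^{p,q}_{V,U}}\le C\,\|[M_B,T]\|_{L^p(U^{p/q})\to L^q(V)},$$ where $C$ possibly depends on $m,p,d$ and $T$ but is independent of $U$, $V$ and $B$.
   Context: Throughout $0<\alpha<d$ is fixed, $p,q>1$ and $\frac{\alpha}{d}+\frac1q=\frac1p$ (so $q$ is determined by $p,\alpha,d$); $p'$ is the conjugate exponent of $p$. $\fint_Q$ denotes the unweighted average over a cube $Q\subseteq\mathbb{R}^d$; $\|\cdot\|$ applied to a matrix is the operator norm. An $n\times n$ matrix weight is a function $W$ on $\mathbb{R}^d$ with values in the $n\times n$ complex matrices that is positive definite a.e. For $r>1$, $L^r(W)$ is the space of $\mathbb{C}^n$-valued $\vec f$ with $\|\vec f\|_{L^r(W)}=\left(\int_{\mathbb{R}^d}|W^{1/r}(x)\vec f(x)|^r\,dx\right)^{1/r}<\infty$. $W$ is a matrix $A_{p,q}$ weight if $$\|W\|_{A_{p,q}}=\sup_Q\fint_Q\left(\fint_Q\|W^{1/q}(x)W^{-1/q}(y)\|^{p'}\,dy\right)^{q/p'}dx<\infty .$$ A linear operator $T$ on scalar functions is canonically extended to $\mathbb{C}^n$-valued functions by applying $T$ to each coordinate in an orthonormal basis (independent of the basis); the extension is again denoted $T$. $M_B$ is multiplication by $B$ and $[M_B,T]=M_BT-TM_B$. For matrix weights $U,V$, $$\|B\|_{\widetilde{\mathrm{BMO}}^{p,q}_{V,U}}^q=\sup_Q\fint_Q\left(\fint_Q\left\|V^{1/q}(x)(B(x)-B(y))U^{-1/q}(y)\right\|^{p'}dy\right)^{q/p'}dx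 .$$ A linear operator $T$ acting on scalar functions is a fractional lower bound operator if for every $n\in\mathbb{N}$: (a) there is a constant $c$, independent of $W$ (but possibly depending on $n$), such that $\|W\|_{A_{p,q}}^{1/q}\le c\,\|T\|_{L^p(W^{p/q})\to L^q(W)}$ for every $n\times n$ matrix weight $W$; and (b) $\|T\|_{L^p(W^{p/q})\to L^q(W)}<\infty$ whenever $W$ is an $n\times n$ matrix $A_{p,q}$ weight. *)

theory Defs
  imports "HOL-Analysis.Analysis" "Jordan_Normal_Form.Schur_Decomposition"
begin

unbundle no vec_syntax

text \<open>
  Vectors and matrices of varying size are those of \<open>Jordan_Normal_Form\<close>, since the notion of
  fractional lower bound operator quantifies over the size. The ambient space \<open>\<real>\<^sup>d\<close> is a Euclidean
  space \<open>'a\<close> with \<open>d = DIM('a)\<close>. All (possibly infinite) norms live in \<^typ>\<open>ennreal\<close>.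
\<close>

definition ennreal_rpow :: "ennreal \<Rightarrow> real \<Rightarrow> ennreal" where
  "ennreal_rpow x r = (if x = \<infinity> then \<infinity> else ennreal (enn2real x powr r))"
  \<comment> \<open>only meant for exponents \<open>r > 0\<close>\<close>

subsection \<open>Matrices\<close>

definition cvec_norm :: "complex vec \<Rightarrow> real" where
  "cvec_norm v = sqrt (\<Sum>i<dim_vec v. (cmod (v $ i))\<^sup>2)"

definition mat_opnorm :: "complex mat \<Rightarrow> real" where
  "mat_opnorm A = Sup {cvec_norm (A *\<^sub>v v) | v. v \<in> carrier_vec (dim_col A) \<and> cvec_norm v \<le> 1}"

definition pos_def_mat :: "nat \<Rightarrow> complex mat \<Rightarrow> bool" where
  "pos_def_mat n A \<longleftrightarrow> A \<in> carrier_mat n n \<and> mat_adjoint A = A \<and>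
     (\<forall>v \<in> carrier_vec n. v \<noteq> 0\<^sub>v n \<longrightarrow> 0 < Re ((A *\<^sub>v v) \<bullet>c v))"

definition unitary_mat :: "nat \<Rightarrow> complex mat \<Rightarrow> bool" where
  "unitary_mat n P \<longleftrightarrow> P \<in> carrier_mat n n \<and> P * mat_adjoint P = 1\<^sub>m n \<and> mat_adjoint P * P = 1\<^sub>m n"

definition unitary_conj :: "nat \<Rightarrow> complex mat \<Rightarrow> (nat \<Rightarrow> real) \<Rightarrow> complex mat" where
  "unitary_conj n P d = P * mat_diag n (\<lambda>i. complex_of_real (d i)) * mat_adjoint P"

text \<open>
  The real power \<open>A\<^sup>s\<close> of a positive definite matrix, by diagonalization:
  if \<open>A = P diag(d) P\<^sup>*\<close> with \<open>P\<close> unitary, then \<open>A\<^sup>s = P diag(d\<^sup>s) P\<^sup>*\<close>. Independence of the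
  chosen diagonalization is \<open>mat_powr_unitary_conj\<close> below. The value is unspecified
  if \<open>A\<close> is not positive definite.
\<close>
definition mat_powr :: "complex mat \<Rightarrow> real \<Rightarrow> complex mat" where
  "mat_powr A s = (THE X. \<exists>P d. unitary_mat (dim_row A) P \<and> (\<forall>i<dim_row A. 0 < d i) \<and>
     A = unitary_conj (dim_row A) P d \<and> X = unitary_conj (dim_row A) P (\<lambda>i. d i powr s))"

subsection \<open>Matrix weights\<close>

definition measurable_mat :: "nat \<Rightarrow> ('a::euclidean_space \<Rightarrow> complex mat) \<Rightarrow> bool" where
  "measurable_mat n W \<longleftrightarrow> (\<forall>x. W x \<in> carrier_mat n n) \<and>
     (\<forall>i<n. \<forall>j<n. (\<lambda>x. W x $$ (i, j)) \<in> borel_measurable lebesgue)"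

definition matrix_weight :: "nat \<Rightarrow> ('a::euclidean_space \<Rightarrow> complex mat) \<Rightarrow> bool" where
  "matrix_weight n W \<longleftrightarrow> measurable_mat n W \<and> (AE x in lebesgue. pos_def_mat n (W x))"

definition locally_integrable_mat :: "nat \<Rightarrow> ('a::euclidean_space \<Rightarrow> complex mat) \<Rightarrow> bool" where
  "locally_integrable_mat n B \<longleftrightarrow> (\<forall>x. B x \<in> carrier_mat n n) \<and>
     (\<forall>i<n. \<forall>j<n. \<forall>K. compact K \<longrightarrow> set_integrable lebesgue K (\<lambda>x. B x $$ (i, j)))"

definition cubes :: "'a::euclidean_space set set" where
  "cubes = {cbox a (a + l *\<^sub>R One) | a l. 0 < l}"

definition average :: "'a::euclidean_space set \<Rightarrow> ('a \<Rightarrow> ennreal) \<Rightarrow> ennreal" where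
  "average Q g = (\<integral>\<^sup>+x\<in>Q. g x \<partial>lebesgue) / emeasure lebesgue Q"

definition conj_exp :: "real \<Rightarrow> real" where
  "conj_exp p = p / (p - 1)"

definition Apq_const :: "real \<Rightarrow> real \<Rightarrow> ('a::euclidean_space \<Rightarrow> complex mat) \<Rightarrow> ennreal" where
  "Apq_const p q W = (SUP Q\<in>cubes. average Q (\<lambda>x. ennreal_rpow
     (average Q (\<lambda>y. ennreal
        (mat_opnorm (mat_powr (W x) (1/q) * mat_powr (W y) (-1/q)) powr conj_exp p)))
     (q / conj_exp p)))"

definition Apq_weight :: "nat \<Rightarrow> real \<Rightarrow> real \<Rightarrow> ('a::euclidean_space \<Rightarrow> complex mat) \<Rightarrow> bool" where
  "Apq_weight n p q W \<longleftrightarrow> matrix_weight n W \<and> Apq_const p q W < \<infinity>"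

definition bmo_norm :: "real \<Rightarrow> real \<Rightarrow> ('a::euclidean_space \<Rightarrow> complex mat) \<Rightarrow>
    ('a \<Rightarrow> complex mat) \<Rightarrow> ('a \<Rightarrow> complex mat) \<Rightarrow> ennreal" where
  "bmo_norm p q V U B = ennreal_rpow (SUP Q\<in>cubes. average Q (\<lambda>x. ennreal_rpow
     (average Q (\<lambda>y. ennreal
        (mat_opnorm (mat_powr (V x) (1/q) * (B x - B y) * mat_powr (U y) (-1/q)) powr conj_exp p)))
     (q / conj_exp p))) (1/q)"

subsection \<open>Weighted spaces and operators\<close>

definition wnorm :: "real \<Rightarrow> ('a::euclidean_space \<Rightarrow> complex mat) \<Rightarrow> ('a \<Rightarrow> complex vec) \<Rightarrow> ennreal" where
  "wnorm r W f = ennreal_rpow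
     (\<integral>\<^sup>+x. ennreal (cvec_norm (mat_powr (W x) (1/r) *\<^sub>v f x) powr r) \<partial>lebesgue) (1/r)"

definition wLp :: "nat \<Rightarrow> real \<Rightarrow> ('a::euclidean_space \<Rightarrow> complex mat) \<Rightarrow> ('a \<Rightarrow> complex vec) set" where
  "wLp n r W = {f. (\<forall>x. f x \<in> carrier_vec n) \<and>
     (\<forall>i<n. (\<lambda>x. f x $ i) \<in> borel_measurable lebesgue) \<and> wnorm r W f < \<infinity>}"

text \<open>
  An operator on scalar functions (such as a fractional integral) is usually not defined on all
  measurable functions, so it is given together with its domain \<open>D\<close>. Functions are identified
  up to null sets, hence linearity is required almost everywhere.
\<close>
definition linear_operator ::
    "('a::euclidean_space \<Rightarrow> complex) set \<Rightarrow> (('a \<Rightarrow> complex) \<Rightarrow> ('a \<Rightarrow> complex)) \<Rightarrow> bool" where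
  "linear_operator D T \<longleftrightarrow>
     D \<subseteq> borel_measurable lebesgue \<and> (\<lambda>x. 0) \<in> D \<and>
     (\<forall>f\<in>D. T f \<in> borel_measurable lebesgue) \<and>
     (\<forall>f\<in>D. \<forall>g\<in>D. (\<lambda>x. f x + g x) \<in> D \<and>
        (AE x in lebesgue. T (\<lambda>x. f x + g x) x = T f x + T g x)) \<and>
     (\<forall>c. \<forall>f\<in>D. (\<lambda>x. c * f x) \<in> D \<and> (AE x in lebesgue. T (\<lambda>x. c * f x) x = c * T f x))"

definition vec_dom :: "nat \<Rightarrow> ('a \<Rightarrow> complex) set \<Rightarrow> ('a \<Rightarrow> complex vec) set" where
  "vec_dom n D = {f. (\<forall>x. f x \<in> carrier_vec n) \<and> (\<forall>i<n. (\<lambda>x. f x $ i) \<in> D)}"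

definition vec_ext :: "nat \<Rightarrow> (('a \<Rightarrow> complex) \<Rightarrow> ('a \<Rightarrow> complex)) \<Rightarrow>
    ('a \<Rightarrow> complex vec) \<Rightarrow> ('a \<Rightarrow> complex vec)" where
  "vec_ext n T f = (\<lambda>x. Matrix.vec n (\<lambda>i. T (\<lambda>y. f y $ i) x))"

definition mult_op :: "('a \<Rightarrow> complex mat) \<Rightarrow> ('a \<Rightarrow> complex vec) \<Rightarrow> ('a \<Rightarrow> complex vec)" where
  "mult_op B f = (\<lambda>x. B x *\<^sub>v f x)"

definition commutator :: "nat \<Rightarrow> ('a \<Rightarrow> complex mat) \<Rightarrow> (('a \<Rightarrow> complex) \<Rightarrow> ('a \<Rightarrow> complex)) \<Rightarrow>
    ('a \<Rightarrow> complex vec) \<Rightarrow> ('a \<Rightarrow> complex vec)" where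
  "commutator n B T f = (\<lambda>x. mult_op B (vec_ext n T f) x - vec_ext n T (mult_op B f) x)"

definition commutator_dom ::
    "nat \<Rightarrow> ('a \<Rightarrow> complex mat) \<Rightarrow> ('a \<Rightarrow> complex) set \<Rightarrow> ('a \<Rightarrow> complex vec) set" where
  "commutator_dom n B D = {f \<in> vec_dom n D. mult_op B f \<in> vec_dom n D}"

text \<open>
  The norm of an operator \<open>S\<close> with domain \<open>E\<close> from \<open>L\<^sup>p(W\<^sub>1)\<close> to \<open>L\<^sup>q(W\<^sub>2)\<close>; the
  supremum runs over those \<open>f\<close> for which \<open>S f\<close> is defined, and is infinite if \<open>S\<close> is unbounded.
\<close>
definition op_norm :: "nat \<Rightarrow> real \<Rightarrow> ('a::euclidean_space \<Rightarrow> complex mat) \<Rightarrow> real \<Rightarrow>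
    ('a \<Rightarrow> complex mat) \<Rightarrow> ('a \<Rightarrow> complex vec) set \<Rightarrow>
    (('a \<Rightarrow> complex vec) \<Rightarrow> ('a \<Rightarrow> complex vec)) \<Rightarrow> ennreal" where
  "op_norm n p W1 q W2 E S = (SUP f\<in>{f \<in> wLp n p W1 \<inter> E. wnorm p W1 f \<le> 1}. wnorm q W2 (S f))"

definition weight_powr :: "('a \<Rightarrow> complex mat) \<Rightarrow> real \<Rightarrow> ('a \<Rightarrow> complex mat)" where
  "weight_powr W s = (\<lambda>x. mat_powr (W x) s)"

text \<open>
  Finiteness of the norm on \<open>L\<^sup>p(W\<^bsup>p/q\<^esup>)\<close> for an \<open>A\<^bsub>p,q\<^esub>\<close> weight includes that the operator is
  defined on the whole of that space.
\<close>
definition fractional_lower_bound_operator :: "real \<Rightarrow> real \<Rightarrow>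
    ('a::euclidean_space \<Rightarrow> complex) set \<Rightarrow> (('a \<Rightarrow> complex) \<Rightarrow> ('a \<Rightarrow> complex)) \<Rightarrow> bool" where
  "fractional_lower_bound_operator p q D T \<longleftrightarrow> linear_operator D T \<and>
     (\<forall>n\<ge>1.
       (\<exists>c>0. \<forall>W. matrix_weight n W \<longrightarrow>
          ennreal_rpow (Apq_const p q W) (1/q) \<le>
          ennreal c * op_norm n p (weight_powr W (p/q)) q W (vec_dom n D) (vec_ext n T)) \<and>
       (\<forall>W. Apq_weight n p q W \<longrightarrow>
          wLp n p (weight_powr W (p/q)) \<subseteq> vec_dom n D \<and>
          op_norm n p (weight_powr W (p/q)) q W (vec_dom n D) (vec_ext n T) < \<infinity>))"

subsection \<open>Real powers are well defined\<close>

lemma unitary_conj_powr_unique: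
  assumes P: "unitary_mat n P" and Q: "unitary_mat n Q"
    and d: "\<forall>i<n. 0 < d i" and e: "\<forall>i<n. 0 < e i"
    and eq: "unitary_conj n P d = unitary_conj n Q e"
  shows "unitary_conj n P (\<lambda>i. d i powr s) = unitary_conj n Q (\<lambda>i. e i powr s)"
proof -
  have adj: "mat_adjoint A \<in> carrier_mat n n" if "A \<in> carrier_mat n n" for A :: "complex mat"
    using that by (auto simp: mat_adjoint_def mat_of_rows_def)
  define P' Q' where "P' = mat_adjoint P" and "Q' = mat_adjoint Q"
  have c[simp]: "P \<in> carrier_mat n n" "Q \<in> carrier_mat n n" "P' \<in> carrier_mat n n" "Q' \<in> carrier_mat n n"
    and u: "P * P' = 1\<^sub>m n" "P' * P = 1\<^sub>m n" "Q * Q' = 1\<^sub>m n" "Q' * Q = 1\<^sub>m n"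
    using P Q adj by (auto simp: unitary_mat_def P'_def Q'_def)
  define dg where "dg f = mat_diag n (\<lambda>i. complex_of_real (f i))" for f
  have dgc[simp]: "dg f \<in> carrier_mat n n" for f by (simp add: dg_def)
  define R where "R = Q' * P"
  have Rc[simp]: "R \<in> carrier_mat n n" unfolding R_def using c by (metis mult_carrier_mat)
  have uc: "unitary_conj n P f = P * dg f * P'" "unitary_conj n Q f = Q * dg f * Q'" for f
    by (auto simp: unitary_conj_def P'_def Q'_def dg_def)
  have mc: "X * Y \<in> carrier_mat n n"
    if "X \<in> carrier_mat n n" "Y \<in> carrier_mat n n" for X Y :: "complex mat"
    using that by (rule mult_carrier_mat)
  have as: "X * Y * Z = X * (Y * Z)"
    if "X \<in> carrier_mat n n" "Y \<in> carrier_mat n n" "Z \<in> carrier_mat n n" for X Y Z :: "complex mat"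
    using that by (rule assoc_mult_mat)
  have one: "1\<^sub>m n * X = X" "X * 1\<^sub>m n = X" if "X \<in> carrier_mat n n" for X :: "complex mat"
    using that by auto
  have canc: "P * (P' * X) = X" "P' * (P * X) = X" "Q * (Q' * X) = X" "Q' * (Q * X) = X"
    if "X \<in> carrier_mat n n" for X
    using as[OF c(1,3) that] as[OF c(3,1) that] as[OF c(2,4) that] as[OF c(4,2) that] one(1)[OF that]
    by (simp_all only: u)
  have l: "Q' * (P * dg f * P') * P = R * dg f" for f
    by (simp only: R_def as mc c dgc u one canc)
  have r: "Q' * (Q * dg f * Q') * P = dg f * R" for f
    by (simp only: R_def as mc c dgc u one canc)
  have b: "Q * (Q' * X * P) * P' = X" if X: "X \<in> carrier_mat n n" for X
    by (simp only: as mc c X u one canc)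
  have RD: "R * dg d = dg e * R" using l[of d] r[of e] eq by (simp add: uc)
  have ent: "(R * dg f) $$ (i,j) = R $$ (i,j) * f j" "(dg f * R) $$ (i,j) = f i * R $$ (i,j)"
    if "i < n" "j < n" for i j f
    using that by (simp_all add: dg_def mat_diag_mult_right[OF Rc] mat_diag_mult_left[OF Rc])
  have "R * dg (\<lambda>i. d i powr s) = dg (\<lambda>i. e i powr s) * R"
  proof (rule eq_matI)
    fix i j assume ij: "i < dim_row (dg (\<lambda>i. e i powr s) * R)" "j < dim_col (dg (\<lambda>i. e i powr s) * R)"
    have ij: "i < n" "j < n" using ij carrier_matD[OF Rc] carrier_matD[OF dgc] by simp_all
    have "R $$ (i,j) * d j = e i * R $$ (i,j)" using ent[OF ij] RD by (metis (no_types))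
    hence "R $$ (i,j) = 0 \<or> d j = e i" by auto
    thus "(R * dg (\<lambda>i. d i powr s)) $$ (i,j) = (dg (\<lambda>i. e i powr s) * R) $$ (i,j)"
      by (auto simp: ent[OF ij])
  qed (simp_all add: carrier_matD[OF Rc] carrier_matD[OF dgc])
  hence "Q' * (P * dg (\<lambda>i. d i powr s) * P') * P = Q' * (Q * dg (\<lambda>i. e i powr s) * Q') * P"
    by (simp add: l r)
  hence "Q * (Q' * (P * dg (\<lambda>i. d i powr s) * P') * P) * P' =
      Q * (Q' * (Q * dg (\<lambda>i. e i powr s) * Q') * P) * P'" by simp
  thus ?thesis unfolding uc by (subst (asm) (1 2) b) (simp_all only: mc c dgc)
qed

lemma mat_powr_unitary_conj:
  assumes P: "unitary_mat n P" and d: "\<forall>i<n. 0 < d i"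
  shows "mat_powr (unitary_conj n P d) s = unitary_conj n P (\<lambda>i. d i powr s)"
proof -
  have n: "dim_row (unitary_conj n P d) = n"
    using P by (auto simp: unitary_conj_def unitary_mat_def)
  show ?thesis unfolding mat_powr_def n
  proof (rule the_equality)
    show "\<exists>P' d'. unitary_mat n P' \<and> (\<forall>i<n. 0 < d' i) \<and> unitary_conj n P d = unitary_conj n P' d' \<and>
        unitary_conj n P (\<lambda>i. d i powr s) = unitary_conj n P' (\<lambda>i. d' i powr s)"
      using assms by (intro exI[of _ P] exI[of _ d]) simp
  next
    fix X
    assume "\<exists>P' d'. unitary_mat n P' \<and> (\<forall>i<n. 0 < d' i) \<and> unitary_conj n P d = unitary_conj n P' d' \<and>
        X = unitary_conj n P' (\<lambda>i. d' i powr s)"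
    then obtain P' d' where h: "unitary_mat n P'" "\<forall>i<n. 0 < d' i"
        "unitary_conj n P d = unitary_conj n P' d'" "X = unitary_conj n P' (\<lambda>i. d' i powr s)"
      by (elim exE conjE)
    show "X = unitary_conj n P (\<lambda>i. d i powr s)"
      unfolding h(4) by (rule unitary_conj_powr_unique[OF P h(1) d h(2,3), symmetric])
  qed
qed

end

theory Submission
  imports Defs "Jordan_Normal_Form.Spectral_Radius"
begin

unbundle no inner_syntax

text \<open>
  For \<open>r > 0\<close> consider the \<open>2m \<times> 2m\<close> weight \<open>W = (A\<^sup>*A)\<^bsup>q/2\<^esup>\<close>, where \<open>A\<close> is the block triangular matrix with
  rows \<open>(V\<^bsup>1/q\<^esup>, r V\<^bsup>1/q\<^esup>B)\<close> and \<open>(0, U\<^bsup>1/q\<^esup>)\<close>. Since \<open>|W\<^bsup>1/q\<^esup>v| = |Av|\<close>, the \<open>A\<^bsub>p,q\<^esub>\<close> constant of \<open>W\<close>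
  dominates \<open>r\<close> times the BMO norm of \<open>B\<close>, while conjugating \<open>T\<close> by \<open>A\<close> bounds its norm with respect to \<open>W\<close>
  by its norms with respect to \<open>U\<close> and \<open>V\<close> plus \<open>r\<close> times the norm of \<open>[M\<^sub>B,T]\<close>. The lower bound property in dimension
  \<open>2m\<close> connects the two; dividing by \<open>r\<close> and letting \<open>r \<rightarrow> \<infinity>\<close> removes the norms of \<open>T\<close>, which are finite.
\<close>

section \<open>Adjoints and the spectral theorem\<close>

text \<open>The factor \<open>A\<close> is not Hermitian, so it cannot itself serve as W^{1/q}; the
  square root of its Gram matrix differs from it by a unitary factor on the left, which no norm
  sees. Split f = (h, k) and put g = h + r B k. Then A f = (V^{1/q} g, U^{1/q} k), while A T f has
  the components V^{1/q} (T g + r [M_B, T] k) and U^{1/q} T k. Hence the commutator carries a factor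
  r and the norms of T carry none; with r = 1 fixed they would remain as terms that the commutator
  does not control. The lower bound holds for all weights, so W need not be shown to be an A_{p,q}
  weight; the finiteness property is applied to U and V alone, in dimension m. Two points need work
  beyond this algebra. W has to be measurable, although powers are defined through a diagonalization
  chosen separately at each point. And T is defined only on \<open>D\<close>, so T (B k) must first
  be shown to make sense.\<close>

lemma mat_adjoint_index [simp]:
  "i < dim_col A \<Longrightarrow> j < dim_row A \<Longrightarrow> mat_adjoint A $$ (i, j) = conjugate (A $$ (j, i))"
  by (simp add: mat_adjoint_def mat_of_rows_def)

lemma dim_mat_adjoint [simp]:
  "dim_row (mat_adjoint A) = dim_col A" "dim_col (mat_adjoint A) = dim_row A"
  by (simp_all add: mat_adjoint_def)

lemma mat_adjoint_carrier [intro]: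
  "A \<in> carrier_mat n k \<Longrightarrow> mat_adjoint A \<in> carrier_mat k n"
  by (metis carrier_matD carrier_matI dim_mat_adjoint)

lemma mat_adjoint_mult:
  fixes A B :: "complex mat"
  assumes "A \<in> carrier_mat n k" "B \<in> carrier_mat k l"
  shows "mat_adjoint (A * B) = mat_adjoint B * mat_adjoint A"
  using assms by (intro eq_matI) (auto simp: scalar_prod_def mult.commute intro!: sum.cong)

lemma mat_adjoint_adjoint [simp]: "mat_adjoint (mat_adjoint A) = (A :: complex mat)"
  by (intro eq_matI) auto

lemma mat_adjoint_mat_diag:
  "mat_adjoint (mat_diag n f) = mat_diag n (\<lambda>i. cnj (f i))"
  by (intro eq_matI) (auto simp: mat_diag_def)

lemma mat_adjoint_four_block_mat:
  fixes A B C E :: "complex mat"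
  assumes "A \<in> carrier_mat n1 m1" "B \<in> carrier_mat n1 m2" "C \<in> carrier_mat n2 m1" "E \<in> carrier_mat n2 m2"
  shows "mat_adjoint (four_block_mat A B C E) =
    four_block_mat (mat_adjoint A) (mat_adjoint C) (mat_adjoint B) (mat_adjoint E)"
  using assms by (intro eq_matI) auto

lemma cscalar_prod_adjoint:
  fixes A :: "complex mat"
  assumes "A \<in> carrier_mat n k" "v \<in> carrier_vec k" "w \<in> carrier_vec n"
  shows "(A *\<^sub>v v) \<bullet>c w = v \<bullet>c (mat_adjoint A *\<^sub>v w)"
proof -
  have "(A *\<^sub>v v) \<bullet>c w = (\<Sum>i<n. \<Sum>j<k. A $$ (i,j) * v $ j * cnj (w $ i))"
    using assms by (auto simp: scalar_prod_def sum_distrib_right lessThan_atLeast0 intro!: sum.cong)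
  also have "\<dots> = (\<Sum>j<k. \<Sum>i<n. A $$ (i,j) * v $ j * cnj (w $ i))" by (rule sum.swap)
  also have "\<dots> = v \<bullet>c (mat_adjoint A *\<^sub>v w)"
    using assms by (auto simp: scalar_prod_def sum_distrib_left lessThan_atLeast0 ac_simps intro!: sum.cong)
  finally show ?thesis .
qed

lemma cvec_norm_nonneg [simp]: "0 \<le> cvec_norm v"
  by (simp add: cvec_norm_def sum_nonneg)

lemma cscalar_prod_self: "v \<bullet>c v = complex_of_real ((cvec_norm v)\<^sup>2)"
proof -
  have "(cvec_norm v)\<^sup>2 = (\<Sum>i<dim_vec v. (cmod (v $ i))\<^sup>2)"
    by (simp add: cvec_norm_def sum_nonneg)
  thus ?thesis
    by (auto simp: scalar_prod_def lessThan_atLeast0 complex_norm_square[symmetric] intro!: sum.cong)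
qed

text \<open>For square matrices a left inverse is also a right inverse.\<close>

lemma unitary_matI:
  assumes "P \<in> carrier_mat n n" "mat_adjoint P * P = 1\<^sub>m n"
  shows "unitary_mat n P"
  using assms mat_mult_left_right_inverse[of "mat_adjoint P" n P] by (auto simp: unitary_mat_def)

lemma unitary_mat_mult:
  assumes P: "unitary_mat n P" and Q: "unitary_mat n Q"
  shows "unitary_mat n (P * Q)"
proof (rule unitary_matI)
  have c: "P \<in> carrier_mat n n" "Q \<in> carrier_mat n n" using P Q by (auto simp: unitary_mat_def)
  hence c': "mat_adjoint P \<in> carrier_mat n n" "mat_adjoint Q \<in> carrier_mat n n" by auto
  show "P * Q \<in> carrier_mat n n" using c by auto
  have "mat_adjoint (P * Q) * (P * Q) = mat_adjoint Q * (mat_adjoint P * P * Q)"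
    using c c' by (simp add: mat_adjoint_mult[OF c] assoc_mult_mat[of _ n n _ n _ n])
  thus "mat_adjoint (P * Q) * (P * Q) = 1\<^sub>m n" using P Q c by (simp add: unitary_mat_def)
qed

text \<open>\<open>gram_schmidt\<close> keeps the first vector of its list, so a basis starting with
  \<open>v\<close> yields an orthogonal basis starting with \<open>v\<close>. The result is
  orthogonal but not normalized; dividing by the norms gives the columns of a unitary
  matrix.\<close>

lemma ex_unitary_mat_first_col:
  assumes v: "v \<in> carrier_vec n" "v \<noteq> 0\<^sub>v n"
  shows "\<exists>W k. unitary_mat n W \<and> col W 0 = k \<cdot>\<^sub>v v"
proof -
  interpret cof_vec_space n "TYPE(complex)" .
  define b where "b = basis_completion v"
  define ws where "ws = gram_schmidt n b"
  from basis_completion[OF v, folded b_def]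
  have dist_b: "distinct b" and indep: "\<not> lin_dep (set b)" and b: "set b \<subseteq> carrier_vec n"
    and hdb: "hd b = v" and len_b: "length b = n" by auto
  have n: "n \<noteq> 0"
  proof
    assume "n = 0"
    with v show False by auto
  qed
  from hdb len_b n obtain vs where bv: "b = v # vs" by (cases b, auto)
  from gram_schmidt_result[OF b dist_b indep refl, folded ws_def]
  have ws: "set ws \<subseteq> carrier_vec n" "corthogonal ws" "length ws = n" by (auto simp: len_b)
  from gram_schmidt_hd[OF v(1), of vs, folded bv] have hdws: "hd ws = v" unfolding ws_def .
  define u where "u w = complex_of_real (1 / cvec_norm w) \<cdot>\<^sub>v w" for w
  define W where "W = mat_of_cols n (map u ws)"
  have W: "W \<in> carrier_mat n n" unfolding W_def using ws by auto
  have wsi: "ws ! i \<in> carrier_vec n" if "i < n" for i using that ws by auto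
  have cW: "col W i = u (ws ! i)" if "i < n" for i
    unfolding W_def using that ws wsi[OF that] by (subst col_mat_of_cols) (auto simp: u_def)
  have "mat_adjoint W * W = 1\<^sub>m n"
  proof (rule eq_matI)
    fix i j assume "i < dim_row (1\<^sub>m n :: complex mat)" "j < dim_col (1\<^sub>m n :: complex mat)"
    hence ij: "i < n" "j < n" by auto
    have "(mat_adjoint W * W) $$ (i,j) = col W j \<bullet>c col W i"
      using ij W by (auto simp: scalar_prod_def mult.commute intro!: sum.cong)
    also have "\<dots> = complex_of_real (1 / cvec_norm (ws ! j)) * complex_of_real (1 / cvec_norm (ws ! i))
        * (ws ! j \<bullet>c ws ! i)"
      using ij wsi by (simp add: cW u_def conjugate_smult_vec
          scalar_prod_smult_distrib[OF wsi]
          smult_scalar_prod_distrib[OF wsi]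
          del: of_real_divide)
    also have "\<dots> = 1\<^sub>m n $$ (i,j)"
    proof (cases "i = j")
      case True
      have "ws ! i \<bullet>c ws ! i \<noteq> 0" using corthogonalD[OF ws(2)] ij ws(3) by auto
      hence "cvec_norm (ws ! i) \<noteq> 0" by (simp add: cscalar_prod_self)
      thus ?thesis using ij True by (simp add: cscalar_prod_self power2_eq_square)
    next
      case False
      hence "ws ! j \<bullet>c ws ! i = 0" using corthogonalD[OF ws(2), of j i] ij ws(3) by auto
      thus ?thesis using False ij by simp
    qed
    finally show "(mat_adjoint W * W) $$ (i,j) = 1\<^sub>m n $$ (i,j)" .
  qed (use W in auto)
  hence "unitary_mat n W" by (rule unitary_matI[OF W])
  moreover have "col W 0 = complex_of_real (1 / cvec_norm v) \<cdot>\<^sub>v v"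
    using cW[of 0] n hdws ws(3) by (cases ws) (auto simp: u_def)
  ultimately show ?thesis by blast
qed

lemma ex_eigenvector:
  fixes A :: "complex mat"
  assumes A: "A \<in> carrier_mat n n" and n: "0 < n"
  shows "\<exists>v e. v \<in> carrier_vec n \<and> v \<noteq> 0\<^sub>v n \<and> A *\<^sub>v v = e \<cdot>\<^sub>v v"
proof -
  have "spectrum A \<noteq> {}" using spectrum_non_empty[OF A] n by auto
  then obtain e where "eigenvalue A e" by (auto simp: spectrum_def)
  thus ?thesis using A by (auto simp: eigenvalue_def eigenvector_def)
qed

text \<open>Induction on the size. Conjugating by a unitary matrix whose first column is an
  eigenvector turns the first column into (e, 0, ..., 0). The conjugate \<open>A'\<close> is again
  Hermitian, so its first row vanishes off the diagonal as well, and the induction hypothesis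
  applies to the remaining block \<open>A3\<close>. The diagonal stays complex here; in the positive
  definite case it is shown to be real and positive afterwards.\<close>

lemma hermitian_mat_diagonalization:
  assumes "A \<in> carrier_mat n n" "mat_adjoint A = (A :: complex mat)"
  shows "\<exists>P c. unitary_mat n P \<and> A = P * mat_diag n c * mat_adjoint P"
  using assms
proof (induction n arbitrary: A)
  case 0
  show ?case
  proof (intro exI conjI)
    show "unitary_mat 0 (1\<^sub>m 0)" by (rule unitary_matI) auto
    show "A = 1\<^sub>m 0 * mat_diag 0 (\<lambda>i. 0) * mat_adjoint (1\<^sub>m 0)"
      using 0 by (intro eq_matI) auto
  qed
next
  case (Suc n)
  note A = Suc.prems(1) and herm = Suc.prems(2)
  let ?N = "Suc n"
  obtain v e where v: "v \<in> carrier_vec ?N" "v \<noteq> 0\<^sub>v ?N" and ev: "A *\<^sub>v v = e \<cdot>\<^sub>v v"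
    using ex_eigenvector[OF A] by auto
  obtain W k where W: "unitary_mat ?N W" and colW: "col W 0 = k \<cdot>\<^sub>v v"
    using ex_unitary_mat_first_col[OF v] by blast
  define W' where "W' = mat_adjoint W"
  have Wc: "W \<in> carrier_mat ?N ?N" and W'c: "W' \<in> carrier_mat ?N ?N"
    and W'W: "W' * W = 1\<^sub>m ?N" and WW': "W * W' = 1\<^sub>m ?N"
    using W by (auto simp: unitary_mat_def W'_def)
  define A' where "A' = W' * (A * W)"
  have A': "A' \<in> carrier_mat ?N ?N" using Wc W'c A by (auto simp: A'_def)
  have A'h: "mat_adjoint A' = A'"
    unfolding A'_def using A Wc W'c herm
    by (simp add: mat_adjoint_mult[of _ ?N ?N _ ?N] W'_def assoc_mult_mat[of _ ?N ?N _ ?N _ ?N])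
  have AW0: "col (A * W) 0 = e \<cdot>\<^sub>v col W 0"
    using A Wc v ev by (subst col_mult2[OF A Wc]) (auto simp: colW mult_mat_vec smult_smult_assoc mult.commute)
  have col0: "A' $$ (i, 0) = (if i = 0 then e else 0)" if i: "i < ?N" for i
  proof -
    have "A' $$ (i, 0) = row W' i \<bullet> (e \<cdot>\<^sub>v col W 0)"
      unfolding A'_def using i W'c Wc A AW0 by auto
    also have "\<dots> = e * (W' * W) $$ (i, 0)"
      using i W'c Wc by simp
    finally show ?thesis using i by (simp add: W'W)
  qed
  have row0: "A' $$ (0, j) = 0" if j: "j < ?N" "j \<noteq> 0" for j
  proof -
    have "A' $$ (0, j) = mat_adjoint A' $$ (0, j)" by (simp add: A'h)
    also have "\<dots> = cnj (A' $$ (j, 0))" using A' j by simp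
    finally show ?thesis using col0[OF j(1)] j by simp
  qed
  define A3 where "A3 = mat n n (\<lambda>(i, j). A' $$ (Suc i, Suc j))"
  have A3: "A3 \<in> carrier_mat n n" by (simp add: A3_def)
  have "mat_adjoint A3 = A3"
  proof (rule eq_matI)
    fix i j assume "i < dim_row A3" "j < dim_col A3"
    hence ij: "i < n" "j < n" by (auto simp: A3_def)
    have "mat_adjoint A' $$ (Suc i, Suc j) = A' $$ (Suc i, Suc j)" by (simp add: A'h)
    thus "mat_adjoint A3 $$ (i, j) = A3 $$ (i, j)" using ij A' by (simp add: A3_def)
  qed (auto simp: A3_def)
  from Suc.IH[OF A3 this] obtain P c where P: "unitary_mat n P"
    and A3P: "A3 = P * mat_diag n c * mat_adjoint P" by blast
  define P' where "P' = mat_adjoint P"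
  have Pc: "P \<in> carrier_mat n n" "P' \<in> carrier_mat n n" and P'P: "P' * P = 1\<^sub>m n"
    using P by (auto simp: unitary_mat_def P'_def)
  define R where "R = four_block_mat (1\<^sub>m 1) (0\<^sub>m 1 n) (0\<^sub>m n 1) P"
  define D where "D = mat_diag ?N (\<lambda>i. if i = 0 then e else c (i - 1))"
  have Rc: "R \<in> carrier_mat ?N ?N" using Pc by (auto simp: R_def)
  have R': "mat_adjoint R = four_block_mat (1\<^sub>m 1) (0\<^sub>m 1 n) (0\<^sub>m n 1) P'"
    unfolding R_def P'_def using Pc
    by (subst mat_adjoint_four_block_mat[of _ 1 1 _ n _ n]) (auto intro!: cong_four_block_mat)
  have "mat_adjoint R * R = four_block_mat (1\<^sub>m 1) (0\<^sub>m 1 n) (0\<^sub>m n 1) (1\<^sub>m n)"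
    unfolding R' unfolding R_def using Pc P'P
    by (subst mult_four_block_mat[of _ 1 1 _ n _ n _ _ 1 _ n]) (auto intro!: cong_four_block_mat)
  also have "\<dots> = 1\<^sub>m ?N" by (intro eq_matI) auto
  finally have R: "unitary_mat ?N R" by (rule unitary_matI[OF Rc])
  define E where "E = mat_diag 1 (\<lambda>_. e)"
  have E: "E \<in> carrier_mat (Suc 0) (Suc 0)" by (simp add: E_def)
  have [simp]: "0\<^sub>m (Suc 0) n * mat_diag n c = 0\<^sub>m (Suc 0) n" by (intro left_mult_zero_mat) auto
  have Dblock: "D = four_block_mat E (0\<^sub>m 1 n) (0\<^sub>m n 1) (mat_diag n c)"
    by (intro eq_matI) (auto simp: D_def mat_diag_def E_def)
  have A'block: "A' = four_block_mat E (0\<^sub>m 1 n) (0\<^sub>m n 1) A3"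
    using A' by (intro eq_matI) (auto simp: A3_def mat_diag_def E_def col0 row0)
  have [simp]: "E \<in> carrier_mat 1 1" "mat_diag n c \<in> carrier_mat n n" by (auto simp: E_def)
  have Dc: "D \<in> carrier_mat ?N ?N" by (simp add: D_def)
  have "R * D = four_block_mat E (0\<^sub>m 1 n) (0\<^sub>m n 1) (P * mat_diag n c)"
    unfolding R_def Dblock using Pc E
    by (subst mult_four_block_mat[of _ 1 1 _ n _ n _ _ 1 _ n]) (auto intro!: cong_four_block_mat simp: left_mult_one_mat[of _ 1 1] left_mult_zero_mat[of _ 1])
  hence "R * D * mat_adjoint R = A'"
    unfolding R' A'block A3P P'_def[symmetric] using Pc E
    by (simp, subst mult_four_block_mat[of _ 1 1 _ n _ n _ _ 1 _ n]) (auto intro!: cong_four_block_mat simp: left_mult_one_mat[of _ 1 1] left_mult_zero_mat[of _ 1])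
  hence "W * A' * W' = W * (R * D * mat_adjoint R) * W'" by simp
  also have "\<dots> = (W * R) * D * mat_adjoint (W * R)"
    using Wc W'c Rc Dc unfolding mat_adjoint_mult[OF Wc Rc]
    by (simp add: assoc_mult_mat[of _ ?N ?N _ ?N _ ?N] mult_carrier_mat[of _ ?N ?N _ ?N] mat_adjoint_carrier W'_def)
  also have "W * A' * W' = (W * W') * A * (W * W')"
    unfolding A'_def using Wc W'c A by (simp add: assoc_mult_mat[of _ ?N ?N _ ?N _ ?N])
  also have "\<dots> = A" using A by (simp add: WW')
  finally show ?case using unitary_mat_mult[OF W R] unfolding D_def by blast
qed

lemma unitary_conj_carrier [simp]:
  "P \<in> carrier_mat n n \<Longrightarrow> unitary_conj n P d \<in> carrier_mat n n"
  by (auto simp: unitary_conj_def)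

lemma mat_diag_mult_vec:
  assumes "v \<in> carrier_vec n"
  shows "mat_diag n f *\<^sub>v v = vec n (\<lambda>i. f i * v $ i)"
  using assms by (intro eq_vecI)
    (auto simp: mat_diag_def scalar_prod_def if_distrib[of "\<lambda>x. x * _"] cong: if_cong)

text \<open>The column \<open>P *\<^sub>v unit_vec n i\<close> is an eigenvector for
  \<open>c i\<close>. Moving \<open>A\<close> across the scalar product shows that
  \<open>c i\<close> is real, and the quadratic form at this vector shows that it is
  positive.\<close>

lemma pos_def_mat_diagonalization:
  assumes A: "pos_def_mat n A"
  shows "\<exists>P d. unitary_mat n P \<and> (\<forall>i<n. 0 < d i) \<and> A = unitary_conj n P d"
proof -
  have Ac: "A \<in> carrier_mat n n" and Ah: "mat_adjoint A = A"
    and Apos: "\<And>v. v \<in> carrier_vec n \<Longrightarrow> v \<noteq> 0\<^sub>v n \<Longrightarrow> 0 < Re ((A *\<^sub>v v) \<bullet>c v)"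
    using A by (auto simp: pos_def_mat_def)
  obtain P c where P: "unitary_mat n P" and Aeq: "A = P * mat_diag n c * mat_adjoint P"
    using hermitian_mat_diagonalization[OF Ac Ah] by blast
  have Pc: "P \<in> carrier_mat n n" "mat_adjoint P \<in> carrier_mat n n"
    and P'P: "mat_adjoint P * P = 1\<^sub>m n" using P by (auto simp: unitary_mat_def)
  have c: "0 < Re (c i) \<and> c i = complex_of_real (Re (c i))" if i: "i < n" for i
  proof -
    define w where "w = P *\<^sub>v unit_vec n i"
    have w: "w \<in> carrier_vec n" using Pc by (auto simp: w_def)
    have P'w: "mat_adjoint P *\<^sub>v w = unit_vec n i"
      unfolding w_def using Pc P'P
      by (subst assoc_mult_mat_vec[symmetric, of _ n n _ n]) auto
    have w0: "w \<noteq> 0\<^sub>v n"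
    proof
      assume "w = 0\<^sub>v n"
      hence "unit_vec n i = mat_adjoint P *\<^sub>v 0\<^sub>v n" using P'w by simp
      also have "\<dots> = 0\<^sub>v n" using Pc by (intro eq_vecI) auto
      finally have "unit_vec n i = (0\<^sub>v n :: complex vec)" .
      hence "unit_vec n i $ i = (0\<^sub>v n $ i :: complex)" by simp
      thus False using i by simp
    qed
    have "A *\<^sub>v w = P *\<^sub>v (mat_diag n c *\<^sub>v (mat_adjoint P *\<^sub>v w))"
      unfolding Aeq using Pc w by (simp add: assoc_mult_mat_vec[of _ n n _ n] mult_carrier_mat[of _ n n _ n] mult_mat_vec_carrier[of _ n n])
    also have "mat_diag n c *\<^sub>v (mat_adjoint P *\<^sub>v w) = c i \<cdot>\<^sub>v unit_vec n i"
      unfolding P'w using i by (subst mat_diag_mult_vec) (auto intro!: eq_vecI)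
    also have "P *\<^sub>v \<dots> = c i \<cdot>\<^sub>v w" unfolding w_def using Pc by (intro mult_mat_vec) auto
    finally have Aw: "A *\<^sub>v w = c i \<cdot>\<^sub>v w" .
    have 1: "(A *\<^sub>v w) \<bullet>c w = c i * complex_of_real ((cvec_norm w)\<^sup>2)"
      using w by (simp add: Aw cscalar_prod_self)
    have "(A *\<^sub>v w) \<bullet>c w = w \<bullet>c (A *\<^sub>v w)"
      using cscalar_prod_adjoint[OF Ac w w] Ah by simp
    also have "\<dots> = cnj (c i) * complex_of_real ((cvec_norm w)\<^sup>2)"
      using w scalar_prod_smult_distrib[OF w carrier_vec_conjugate[OF w]]
      by (simp add: Aw conjugate_smult_vec cscalar_prod_self)
    finally have 2: "c i * complex_of_real ((cvec_norm w)\<^sup>2) = cnj (c i) * complex_of_real ((cvec_norm w)\<^sup>2)"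
      using 1 by simp
    have 3: "0 < Re (c i) * (cvec_norm w)\<^sup>2" using Apos[OF w w0] by (simp add: 1)
    hence pos: "0 < (cvec_norm w)\<^sup>2" by (metis mult_zero_right order_less_irrefl zero_le_power2 order_le_less)
    from 2 pos have "c i = cnj (c i)" by simp
    hence "c i = complex_of_real (Re (c i))" by (simp add: complex_eq_iff)
    moreover have "0 < Re (c i)" using 3 pos by (simp add: zero_less_mult_iff)
    ultimately show ?thesis by blast
  qed
  have "mat_diag n c = mat_diag n (\<lambda>i. complex_of_real (Re (c i)))"
    using c by (intro eq_matI) (auto simp: mat_diag_def)
  hence "A = unitary_conj n P (\<lambda>i. Re (c i))" by (simp add: Aeq unitary_conj_def)
  moreover have "\<forall>i<n. 0 < Re (c i)" using c by simp
  ultimately show ?thesis using P by (intro exI[of _ P] exI[of _ "\<lambda>i. Re (c i)"] conjI)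
qed

section \<open>Real powers of positive definite matrices\<close>

lemma unitary_conj_mult:
  assumes "unitary_mat n P"
  shows "unitary_conj n P f * unitary_conj n P g = unitary_conj n P (\<lambda>i. f i * g i)"
proof -
  have Pc: "P \<in> carrier_mat n n" "mat_adjoint P \<in> carrier_mat n n"
    and P'P: "mat_adjoint P * P = 1\<^sub>m n" using assms by (auto simp: unitary_mat_def)
  let ?d = "\<lambda>f. mat_diag n (\<lambda>i. complex_of_real (f i))"
  have "unitary_conj n P f * unitary_conj n P g =
      P * (?d f * ((mat_adjoint P * P) * (?d g * mat_adjoint P)))"
    unfolding unitary_conj_def using Pc by (simp add: assoc_mult_mat[of _ n n _ n _ n] mult_carrier_mat[of _ n n _ n])
  also have "\<dots> = P * (?d f * ?d g) * mat_adjoint P"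
    using Pc unfolding P'P
    by (simp add: assoc_mult_mat[of _ n n _ n _ n] left_mult_one_mat[of _ n n] mult_carrier_mat[of _ n n _ n]
        del: mat_diag_diag)
  finally show ?thesis by (simp add: unitary_conj_def)
qed

lemma unitary_conj_one: "unitary_mat n P \<Longrightarrow> unitary_conj n P (\<lambda>i. 1) = 1\<^sub>m n"
  by (auto simp: unitary_conj_def unitary_mat_def mat_diag_one)

lemma unitary_conj_cong:
  "(\<And>i. i < n \<Longrightarrow> f i = g i) \<Longrightarrow> unitary_conj n P f = unitary_conj n P g"
  unfolding unitary_conj_def by (intro arg_cong2[where f="(*)"] refl eq_matI) (auto simp: mat_diag_def)

text \<open>With \<open>w\<close> the image of \<open>v\<close> under the adjoint of
  \<open>P\<close>, the quadratic form is the sum of \<open>d i\<close> times the squared modulus of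
  \<open>w $ i\<close>, and \<open>w\<close> is nonzero because \<open>P\<close> maps it back to
  \<open>v\<close>.\<close>

lemma pos_def_unitary_conj:
  assumes P: "unitary_mat n P" and d: "\<forall>i<n. 0 < d i"
  shows "pos_def_mat n (unitary_conj n P d)"
  unfolding pos_def_mat_def
proof (intro conjI ballI impI)
  have Pc: "P \<in> carrier_mat n n" "mat_adjoint P \<in> carrier_mat n n"
    and PP': "P * mat_adjoint P = 1\<^sub>m n" using P by (auto simp: unitary_mat_def)
  let ?D = "mat_diag n (\<lambda>i. complex_of_real (d i))"
  show "unitary_conj n P d \<in> carrier_mat n n" using Pc by auto
  show "mat_adjoint (unitary_conj n P d) = unitary_conj n P d"
    unfolding unitary_conj_def using Pc
    by (simp add: mat_adjoint_mult[of _ n n _ n] mat_adjoint_mat_diag assoc_mult_mat[of _ n n _ n _ n]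
        mult_carrier_mat[of _ n n _ n])
  fix v :: "complex vec" assume v: "v \<in> carrier_vec n" "v \<noteq> 0\<^sub>v n"
  define w where "w = mat_adjoint P *\<^sub>v v"
  have w: "w \<in> carrier_vec n" using Pc v by (auto simp: w_def)
  have "P *\<^sub>v w = v" unfolding w_def using Pc PP' v
    by (subst assoc_mult_mat_vec[symmetric, of _ n n _ n]) auto
  moreover have "P *\<^sub>v 0\<^sub>v n = 0\<^sub>v n" using Pc by (intro eq_vecI) auto
  ultimately have w0: "w \<noteq> 0\<^sub>v n" using v by metis
  have D: "?D \<in> carrier_mat n n" by (rule mat_diag_dim)
  have PD: "P * ?D \<in> carrier_mat n n" by (rule mult_carrier_mat[OF Pc(1) D])
  have Dw: "?D *\<^sub>v w \<in> carrier_vec n" by (rule mult_mat_vec_carrier[OF D w])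
  have "unitary_conj n P d *\<^sub>v v = P *\<^sub>v (?D *\<^sub>v w)"
    unfolding unitary_conj_def w_def
    by (simp only: assoc_mult_mat_vec[OF PD Pc(2) v(1)] assoc_mult_mat_vec[OF Pc(1) D w[unfolded w_def]])
  hence "(unitary_conj n P d *\<^sub>v v) \<bullet>c v = (?D *\<^sub>v w) \<bullet>c w"
    using cscalar_prod_adjoint[OF Pc(1) Dw v(1)] by (simp add: w_def)
  also have "\<dots> = (\<Sum>i<n. complex_of_real (d i * (cmod (w $ i))\<^sup>2))"
    unfolding mat_diag_mult_vec[OF w]
    using w by (auto simp: scalar_prod_def lessThan_atLeast0 complex_norm_square[symmetric] mult.assoc intro!: sum.cong)
  finally have "Re ((unitary_conj n P d *\<^sub>v v) \<bullet>c v) = (\<Sum>i<n. d i * (cmod (w $ i))\<^sup>2)" by simp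
  moreover have "(\<Sum>i<n. d i * (cmod (w $ i))\<^sup>2) > 0"
  proof -
    obtain i where i: "i < n" "w $ i \<noteq> 0"
      using w w0 by (metis carrier_vecD eq_vecI index_zero_vec)
    show ?thesis using i d by (intro sum_pos2[of _ i]) (auto intro: mult_nonneg_nonneg less_imp_le)
  qed
  ultimately show "0 < Re ((unitary_conj n P d *\<^sub>v v) \<bullet>c v)" by simp
qed

lemma pos_def_mat_carrier: "pos_def_mat n A \<Longrightarrow> A \<in> carrier_mat n n"
  by (simp add: pos_def_mat_def)

text \<open>One diagonalization of \<open>A\<close> computes all of its powers, since the value does
  not depend on the choice; each law is then a law of \<open>powr\<close> on the
  eigenvalues.\<close>

lemma
  assumes A: "pos_def_mat n A"
  shows pos_def_mat_powr: "pos_def_mat n (mat_powr A s)"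
    and mat_powr_mat_powr: "mat_powr (mat_powr A s) t = mat_powr A (s * t)"
    and mat_powr_add: "mat_powr A (s + t) = mat_powr A s * mat_powr A t"
    and mat_powr_zero: "mat_powr A 0 = 1\<^sub>m n"
    and mat_powr_one: "mat_powr A 1 = A"
proof -
  obtain P d where P: "unitary_mat n P" and d: "\<forall>i<n. 0 < d i" and Aeq: "A = unitary_conj n P d"
    using pos_def_mat_diagonalization[OF A] by blast
  have pw: "mat_powr A s = unitary_conj n P (\<lambda>i. d i powr s)" for s
    unfolding Aeq by (rule mat_powr_unitary_conj[OF P d])
  have d': "\<forall>i<n. 0 < d i powr s" for s using d by auto
  show "pos_def_mat n (mat_powr A s)" unfolding pw by (rule pos_def_unitary_conj[OF P d'])
  show "mat_powr (mat_powr A s) t = mat_powr A (s * t)"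
    unfolding pw by (simp add: mat_powr_unitary_conj[OF P d'] powr_powr)
  show "mat_powr A (s + t) = mat_powr A s * mat_powr A t"
    unfolding pw by (simp add: unitary_conj_mult[OF P] powr_add)
  \<comment> \<open>Here and for exponent 1 the positivity of the eigenvalues matters:
    \<open>powr\<close> maps 0 to 0 even for exponent 0, and exponent 1 does not reproduce negative
    numbers.\<close>
  have "mat_powr A 0 = unitary_conj n P (\<lambda>i. 1)" unfolding pw using d by (intro unitary_conj_cong) auto
  thus "mat_powr A 0 = 1\<^sub>m n" by (simp add: unitary_conj_one[OF P])
  have "mat_powr A 1 = unitary_conj n P d" unfolding pw using d by (intro unitary_conj_cong) (auto simp: less_imp_le)
  thus "mat_powr A 1 = A" by (simp add: Aeq)
qed

lemma pos_def_mat_mult_vec_eq_0: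
  assumes A: "pos_def_mat n A" and v: "v \<in> carrier_vec n" and 0: "A *\<^sub>v v = 0\<^sub>v n"
  shows "v = 0\<^sub>v n"
proof (rule ccontr)
  assume "v \<noteq> 0\<^sub>v n"
  with A v have "0 < Re ((A *\<^sub>v v) \<bullet>c v)" by (auto simp: pos_def_mat_def)
  thus False using v by (simp add: 0)
qed

section \<open>Vector and operator norms\<close>

lemma cvec_norm_L2_set: "cvec_norm v = L2_set (\<lambda>i. cmod (v $ i)) {..<dim_vec v}"
  by (simp add: cvec_norm_def L2_set_def)

lemma cvec_norm_add_le:
  assumes "v \<in> carrier_vec n" "w \<in> carrier_vec n"
  shows "cvec_norm (v + w) \<le> cvec_norm v + cvec_norm w"
proof -
  have "cvec_norm (v + w) \<le> L2_set (\<lambda>i. cmod (v $ i) + cmod (w $ i)) {..<n}"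
    using assms unfolding cvec_norm_L2_set by (auto intro!: L2_set_mono norm_triangle_ineq)
  also have "\<dots> \<le> cvec_norm v + cvec_norm w"
    using assms L2_set_triangle_ineq unfolding cvec_norm_L2_set by auto
  finally show ?thesis .
qed

lemma cvec_norm_smult: "cvec_norm (c \<cdot>\<^sub>v v) = cmod c * cvec_norm v"
  by (simp add: cvec_norm_def norm_mult power_mult_distrib real_sqrt_mult flip: sum_distrib_left)

lemma cvec_norm_append: "(cvec_norm (v @\<^sub>v w))\<^sup>2 = (cvec_norm v)\<^sup>2 + (cvec_norm w)\<^sup>2"
proof -
  have split: "(\<Sum>i<a + b. f i) = (\<Sum>i<a. f i) + (\<Sum>i<b. f (a + i))" for f :: "nat \<Rightarrow> real" and a b
    by (induction b) auto
  have "(\<Sum>i<dim_vec v + dim_vec w. (cmod ((v @\<^sub>v w) $ i))\<^sup>2) =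
     (\<Sum>i<dim_vec v. (cmod ((v @\<^sub>v w) $ i))\<^sup>2) + (\<Sum>i<dim_vec w. (cmod ((v @\<^sub>v w) $ (dim_vec v + i)))\<^sup>2)"
    unfolding split ..
  thus ?thesis by (simp add: cvec_norm_def sum_nonneg)
qed

text \<open>This bounds the set in \<open>mat_opnorm\<close> from above, without which its
  \<open>Sup\<close> would carry no information. The sum of the moduli of all entries serves as
  bound.\<close>

lemma mat_mult_vec_bounded:
  "\<exists>K. \<forall>v\<in>carrier_vec (dim_col A). cvec_norm v \<le> 1 \<longrightarrow> cvec_norm (A *\<^sub>v v) \<le> K"
proof (intro exI ballI impI)
  fix v assume v: "v \<in> carrier_vec (dim_col A)" and n: "cvec_norm v \<le> 1"
  have vi: "cmod (v $ j) \<le> 1" if "j < dim_col A" for j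
    using member_le_L2_set[of "{..<dim_vec v}" j "\<lambda>i. cmod (v $ i)"] that v n
    by (simp add: cvec_norm_L2_set)
  have "cvec_norm (A *\<^sub>v v) \<le> (\<Sum>i<dim_row A. cmod ((A *\<^sub>v v) $ i))"
    unfolding cvec_norm_L2_set by (rule order_trans[OF L2_set_le_sum]) auto
  also have "\<dots> \<le> (\<Sum>i<dim_row A. \<Sum>j<dim_col A. cmod (A $$ (i,j)))"
  proof (rule sum_mono)
    fix i assume i: "i \<in> {..<dim_row A}"
    have "cmod ((A *\<^sub>v v) $ i) = cmod (\<Sum>j<dim_col A. A $$ (i,j) * v $ j)"
      using i v by (auto simp: scalar_prod_def lessThan_atLeast0)
    also have "\<dots> \<le> (\<Sum>j<dim_col A. cmod (A $$ (i,j)))"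
      using vi by (intro sum_norm_le) (auto simp: norm_mult intro: mult_left_le)
    finally show "cmod ((A *\<^sub>v v) $ i) \<le> (\<Sum>j<dim_col A. cmod (A $$ (i,j)))" .
  qed
  finally show "cvec_norm (A *\<^sub>v v) \<le> (\<Sum>i<dim_row A. \<Sum>j<dim_col A. cmod (A $$ (i,j)))" .
qed

lemma cvec_norm_le_mat_opnorm:
  assumes "v \<in> carrier_vec (dim_col A)" "cvec_norm v \<le> 1"
  shows "cvec_norm (A *\<^sub>v v) \<le> mat_opnorm A"
  unfolding mat_opnorm_def
proof (rule cSup_upper)
  obtain K where K: "\<forall>v\<in>carrier_vec (dim_col A). cvec_norm v \<le> 1 \<longrightarrow> cvec_norm (A *\<^sub>v v) \<le> K"
    using mat_mult_vec_bounded by blast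
  show "bdd_above {cvec_norm (A *\<^sub>v v) | v. v \<in> carrier_vec (dim_col A) \<and> cvec_norm v \<le> 1}"
    by (rule bdd_aboveI[of _ K]) (use K in auto)
qed (use assms in auto)

lemma mat_opnorm_le:
  assumes "\<And>v. v \<in> carrier_vec (dim_col A) \<Longrightarrow> cvec_norm v \<le> 1 \<Longrightarrow> cvec_norm (A *\<^sub>v v) \<le> K"
  shows "mat_opnorm A \<le> K"
  unfolding mat_opnorm_def
proof (rule cSup_least)
  have "cvec_norm (0\<^sub>v (dim_col A)) \<le> 1" by (simp add: cvec_norm_def)
  thus "{cvec_norm (A *\<^sub>v v) | v. v \<in> carrier_vec (dim_col A) \<and> cvec_norm v \<le> 1} \<noteq> {}"
    using zero_carrier_vec by blast
qed (use assms in auto)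

lemma mat_opnorm_nonneg: "0 \<le> mat_opnorm A"
proof -
  have "0 \<le> cvec_norm (A *\<^sub>v 0\<^sub>v (dim_col A))" by simp
  also have "\<dots> \<le> mat_opnorm A" by (rule cvec_norm_le_mat_opnorm) (auto simp: cvec_norm_def)
  finally show ?thesis .
qed

text \<open>The quadratic form at \<open>v\<close> is the squared norm of
  \<open>A *\<^sub>v v\<close>, so definiteness amounts to injectivity.\<close>

lemma pos_def_adjoint_mult:
  fixes A :: "complex mat"
  assumes A: "A \<in> carrier_mat n n"
    and inj: "\<And>v. v \<in> carrier_vec n \<Longrightarrow> A *\<^sub>v v = 0\<^sub>v n \<Longrightarrow> v = 0\<^sub>v n"
  shows "pos_def_mat n (mat_adjoint A * A)"
  unfolding pos_def_mat_def
proof (intro conjI ballI impI)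
  have A': "mat_adjoint A \<in> carrier_mat n n" using A by auto
  show "mat_adjoint A * A \<in> carrier_mat n n" using A A' by auto
  show "mat_adjoint (mat_adjoint A * A) = mat_adjoint A * A"
    by (simp add: mat_adjoint_mult[OF A' A])
  fix v :: "complex vec" assume v: "v \<in> carrier_vec n" "v \<noteq> 0\<^sub>v n"
  have Av: "A *\<^sub>v v \<in> carrier_vec n" using A v by auto
  have "A *\<^sub>v v \<noteq> 0\<^sub>v n" using inj[of v] v by auto
  hence "(A *\<^sub>v v) \<bullet>c (A *\<^sub>v v) \<noteq> 0" using conjugate_square_eq_0_vec[OF Av] by simp
  hence pos: "0 < (cvec_norm (A *\<^sub>v v))\<^sup>2" by (simp add: cscalar_prod_self)
  have "((mat_adjoint A * A) *\<^sub>v v) \<bullet>c v = (A *\<^sub>v v) \<bullet>c (A *\<^sub>v v)"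
    using cscalar_prod_adjoint[OF A' Av v(1)] A A' v by (simp add: assoc_mult_mat_vec[of _ n n _ n])
  thus "0 < Re (((mat_adjoint A * A) *\<^sub>v v) \<bullet>c v)" using pos by (simp add: cscalar_prod_self)
qed

text \<open>The root is Hermitian and its square is the Gram matrix, so both squared norms equal the
  quadratic form of the Gram matrix at \<open>v\<close>. This moves computations from the root,
  which has no explicit form, to the factor \<open>A\<close>.\<close>

lemma cvec_norm_sqrt_adjoint_mult:
  fixes A :: "complex mat"
  assumes A: "A \<in> carrier_mat n n" and H: "pos_def_mat n (mat_adjoint A * A)"
    and v: "v \<in> carrier_vec n"
  shows "cvec_norm (mat_powr (mat_adjoint A * A) (1/2) *\<^sub>v v) = cvec_norm (A *\<^sub>v v)"
proof -
  let ?S = "mat_powr (mat_adjoint A * A) (1/2)"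
  have A': "mat_adjoint A \<in> carrier_mat n n" using A by auto
  have S: "?S \<in> carrier_mat n n" "mat_adjoint ?S = ?S"
    using pos_def_mat_powr[OF H] by (auto simp: pos_def_mat_def)
  have SS: "?S * ?S = mat_adjoint A * A"
    using mat_powr_add[OF H, of "1/2" "1/2"] mat_powr_one[OF H] by simp
  have Sv: "?S *\<^sub>v v \<in> carrier_vec n" and Av: "A *\<^sub>v v \<in> carrier_vec n" using S A v by auto
  have "(?S *\<^sub>v v) \<bullet>c (?S *\<^sub>v v) = (mat_adjoint ?S *\<^sub>v (?S *\<^sub>v v)) \<bullet>c v"
    using cscalar_prod_adjoint[OF mat_adjoint_carrier[OF S(1)] Sv v] by simp
  also have "\<dots> = ((mat_adjoint A * A) *\<^sub>v v) \<bullet>c v"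
    using S v by (simp add: assoc_mult_mat_vec[symmetric, OF S(1) S(1) v] SS)
  also have "\<dots> = (A *\<^sub>v v) \<bullet>c (A *\<^sub>v v)"
    using cscalar_prod_adjoint[OF A' Av v(1)] A A' v by (simp add: assoc_mult_mat_vec[of _ n n _ n])
  finally have "(cvec_norm (?S *\<^sub>v v))\<^sup>2 = (cvec_norm (A *\<^sub>v v))\<^sup>2"
    by (simp only: cscalar_prod_self of_real_eq_iff)
  thus ?thesis by (simp add: power2_eq_iff_nonneg)
qed

section \<open>Block Gram matrices\<close>

text \<open>A triangular factor \<open>A\<close> of the Gram matrix \<open>A\<^sup>*A\<close>. With \<open>P = V\<^bsup>1/q\<^esup>\<close> and \<open>R = U\<^bsup>1/q\<^esup>\<close>, the upper right block of
  \<open>A(x) A(y)\<^bsup>-1\<^esup>\<close> is \<open>V\<^bsup>1/q\<^esup>(x) (B(x) - B(y)) U\<^bsup>-1/q\<^esup>(y)\<close>.\<close>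
definition block_factor :: "nat \<Rightarrow> complex mat \<Rightarrow> complex mat \<Rightarrow> complex mat \<Rightarrow> complex mat" where
  "block_factor m P B R = four_block_mat P (P * B) (0\<^sub>m m m) R"

definition block_gram :: "nat \<Rightarrow> complex mat \<Rightarrow> complex mat \<Rightarrow> complex mat \<Rightarrow> complex mat" where
  "block_gram m P B R = mat_adjoint (block_factor m P B R) * block_factor m P B R"

lemma block_factor_carrier:
  "P \<in> carrier_mat m m \<Longrightarrow> R \<in> carrier_mat m m \<Longrightarrow> block_factor m P B R \<in> carrier_mat (m + m) (m + m)"
  by (auto simp: block_factor_def)

lemma block_factor_mult_vec:
  assumes "P \<in> carrier_mat m m" "B \<in> carrier_mat m m" "R \<in> carrier_mat m m"
    and "a \<in> carrier_vec m" "b \<in> carrier_vec m"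
  shows "block_factor m P B R *\<^sub>v (a @\<^sub>v b) = (P *\<^sub>v (a + B *\<^sub>v b)) @\<^sub>v (R *\<^sub>v b)"
proof -
  have Bb: "B *\<^sub>v b \<in> carrier_vec m" using assms by auto
  have "(0\<^sub>m m m *\<^sub>v a) + R *\<^sub>v b = R *\<^sub>v b" using assms by (intro eq_vecI) auto
  moreover have "P *\<^sub>v (a + B *\<^sub>v b) = P *\<^sub>v a + (P * B) *\<^sub>v b"
    using assms Bb by (simp add: mult_add_distrib_mat_vec[of _ m m] assoc_mult_mat_vec[of _ m m _ m])
  ultimately show ?thesis
    unfolding block_factor_def
    using assms by (subst four_block_mat_mult_vec[of _ m m _ m _ m]) auto
qed

text \<open>Back substitution: the lower row forces b = 0, and then the upper row forces a =
  0.\<close>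

lemma pos_def_block_gram:
  assumes P: "pos_def_mat m P" and R: "pos_def_mat m R" and B: "B \<in> carrier_mat m m"
  shows "pos_def_mat (m + m) (block_gram m P B R)"
  unfolding block_gram_def
proof (rule pos_def_adjoint_mult)
  note Pc = pos_def_mat_carrier[OF P] and Rc = pos_def_mat_carrier[OF R]
  show "block_factor m P B R \<in> carrier_mat (m + m) (m + m)" using Pc Rc by (rule block_factor_carrier)
  fix v :: "complex vec" assume v: "v \<in> carrier_vec (m + m)" and v0: "block_factor m P B R *\<^sub>v v = 0\<^sub>v (m + m)"
  define a b where "a = vec_first v m" and "b = vec_last v m"
  have ab: "a \<in> carrier_vec m" "b \<in> carrier_vec m" and vab: "v = a @\<^sub>v b"
    using v by (auto simp: a_def b_def)
  have Bb: "B *\<^sub>v b \<in> carrier_vec m" using B ab by auto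
  have z: "0\<^sub>v (m + m) = 0\<^sub>v m @\<^sub>v (0\<^sub>v m :: complex vec)" by (intro eq_vecI) auto
  have "P *\<^sub>v (a + B *\<^sub>v b) = 0\<^sub>v m \<and> R *\<^sub>v b = 0\<^sub>v m"
    using v0 Pc ab Bb unfolding vab block_factor_mult_vec[OF Pc B Rc ab] z
    by (subst (asm) append_vec_eq[of _ m]) auto
  hence Pz: "a + B *\<^sub>v b = 0\<^sub>v m" and bz: "b = 0\<^sub>v m"
    using pos_def_mat_mult_vec_eq_0[OF P, of "a + B *\<^sub>v b"] pos_def_mat_mult_vec_eq_0[OF R, of b] ab Bb by auto
  have "B *\<^sub>v b = 0\<^sub>v m" unfolding bz using B by (intro eq_vecI) auto
  hence "a = 0\<^sub>v m" using Pz ab by simp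
  thus "v = 0\<^sub>v (m + m)" by (simp add: vab bz z)
qed

lemma cvec_norm_sqrt_block_gram:
  assumes P: "pos_def_mat m P" and R: "pos_def_mat m R" and B: "B \<in> carrier_mat m m"
    and ab: "a \<in> carrier_vec m" "b \<in> carrier_vec m"
  shows "(cvec_norm (mat_powr (block_gram m P B R) (1/2) *\<^sub>v (a @\<^sub>v b)))\<^sup>2 =
    (cvec_norm (P *\<^sub>v (a + B *\<^sub>v b)))\<^sup>2 + (cvec_norm (R *\<^sub>v b))\<^sup>2"
proof -
  note Pc = pos_def_mat_carrier[OF P] and Rc = pos_def_mat_carrier[OF R]
  have "cvec_norm (mat_powr (block_gram m P B R) (1/2) *\<^sub>v (a @\<^sub>v b)) =
      cvec_norm (block_factor m P B R *\<^sub>v (a @\<^sub>v b))"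
    unfolding block_gram_def
    by (rule cvec_norm_sqrt_adjoint_mult[OF block_factor_carrier[OF Pc Rc]
          pos_def_block_gram[OF P R B, unfolded block_gram_def]]) (use ab in auto)
  thus ?thesis by (simp add: block_factor_mult_vec[OF Pc B Rc ab] cvec_norm_append)
qed

lemma smult_mat_mult_vec:
  fixes v :: "complex vec"
  assumes "A \<in> carrier_mat n k" "v \<in> carrier_vec k"
  shows "(c \<cdot>\<^sub>m A) *\<^sub>v v = c \<cdot>\<^sub>v (A *\<^sub>v v)"
  using assms by (intro eq_vecI) (auto simp: scalar_prod_def sum_distrib_left mult.assoc)

text \<open>Up to unitary factors on both sides, the product of the two roots is the first block
  factor times the inverse of the second. Its upper right block is r P1 (B1 - B2) R2', and a block
  has at most the norm of the whole matrix.\<close>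

lemma mat_opnorm_block_gram_ge:
  fixes r :: real
  assumes P1: "pos_def_mat m P1" and R1: "pos_def_mat m R1" and B1: "B1 \<in> carrier_mat m m"
    and P2: "pos_def_mat m P2" and R2: "pos_def_mat m R2" and B2: "B2 \<in> carrier_mat m m"
    and R2': "R2' \<in> carrier_mat m m" "R2 * R2' = 1\<^sub>m m" and r: "0 < r"
  shows "r * mat_opnorm (P1 * (B1 - B2) * R2') \<le>
    mat_opnorm (mat_powr (block_gram m P1 (complex_of_real r \<cdot>\<^sub>m B1) R1) (1/2) *
      mat_powr (block_gram m P2 (complex_of_real r \<cdot>\<^sub>m B2) R2) (-1/2))"
    (is "_ \<le> mat_opnorm ?M")
proof -
  let ?c = "complex_of_real r"
  let ?H1 = "block_gram m P1 (?c \<cdot>\<^sub>m B1) R1" and ?H2 = "block_gram m P2 (?c \<cdot>\<^sub>m B2) R2"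
  have cB1: "?c \<cdot>\<^sub>m B1 \<in> carrier_mat m m" and cB2: "?c \<cdot>\<^sub>m B2 \<in> carrier_mat m m" using B1 B2 by auto
  have H1: "pos_def_mat (m + m) ?H1" and H2: "pos_def_mat (m + m) ?H2"
    by (auto intro!: pos_def_block_gram P1 R1 cB1 P2 R2 cB2)
  note pc = pos_def_mat_powr[THEN pos_def_mat_carrier]
  have Mc: "?M \<in> carrier_mat (m + m) (m + m)" by (rule mult_carrier_mat[OF pc[OF H1] pc[OF H2]])
  have Pc: "P1 \<in> carrier_mat m m" "P2 \<in> carrier_mat m m" using P1 P2 by (auto dest: pos_def_mat_carrier)
  have "mat_opnorm (P1 * (B1 - B2) * R2') \<le> mat_opnorm ?M / r"
  proof (rule mat_opnorm_le)
    fix v :: "complex vec"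
    assume "v \<in> carrier_vec (dim_col (P1 * (B1 - B2) * R2'))" and v1: "cvec_norm v \<le> 1"
    hence v: "v \<in> carrier_vec m" using R2' by auto
    \<comment> \<open>These are chosen so that the second block factor maps
      \<open>a @\<^sub>v b\<close> to (0, v). Hence \<open>u\<close> below has the norm of
      \<open>v\<close>, while the first block factor maps \<open>a @\<^sub>v b\<close> to a vector
      whose upper half is r P1 (B1 - B2) R2' v.\<close>
    define b where "b = R2' *\<^sub>v v"
    define a where "a = - ((?c \<cdot>\<^sub>m B2) *\<^sub>v b)"
    have b: "b \<in> carrier_vec m" using v R2' by (auto simp: b_def)
    have cb: "(?c \<cdot>\<^sub>m B1) *\<^sub>v b \<in> carrier_vec m" "(?c \<cdot>\<^sub>m B2) *\<^sub>v b \<in> carrier_vec m"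
      using cB1 cB2 b by auto
    have a: "a \<in> carrier_vec m" using cb by (auto simp: a_def)
    have R2b: "R2 *\<^sub>v b = v"
      unfolding b_def using pos_def_mat_carrier[OF R2] R2' v
      by (subst assoc_mult_mat_vec[symmetric, of _ m m _ m]) auto
    have a0: "a + (?c \<cdot>\<^sub>m B2) *\<^sub>v b = 0\<^sub>v m" unfolding a_def using cb by auto
    have P20: "P2 *\<^sub>v 0\<^sub>v m = 0\<^sub>v m" using Pc by (intro eq_vecI) auto
    define u where "u = mat_powr ?H2 (1/2) *\<^sub>v (a @\<^sub>v b)"
    have abc: "a @\<^sub>v b \<in> carrier_vec (m + m)" using a b by auto
    have uc: "u \<in> carrier_vec (m + m)" unfolding u_def by (rule mult_mat_vec_carrier[OF pc[OF H2] abc])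
    have "(cvec_norm u)\<^sup>2 = (cvec_norm v)\<^sup>2"
      unfolding u_def cvec_norm_sqrt_block_gram[OF P2 R2 cB2 a b] a0 P20 R2b by (simp add: cvec_norm_def)
    hence "cvec_norm u = cvec_norm v" by (simp add: power2_eq_iff_nonneg)
    hence u1: "cvec_norm u \<le> 1" using v1 by simp
    have "mat_powr ?H2 (-1/2) *\<^sub>v u = (mat_powr ?H2 (-1/2) * mat_powr ?H2 (1/2)) *\<^sub>v (a @\<^sub>v b)"
      unfolding u_def using assoc_mult_mat_vec[OF pc[OF H2] pc[OF H2] abc] by simp
    also have "mat_powr ?H2 (-1/2) * mat_powr ?H2 (1/2) = 1\<^sub>m (m + m)"
      by (subst mat_powr_add[OF H2, symmetric]) (simp add: mat_powr_zero[OF H2])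
    also have "1\<^sub>m (m + m) *\<^sub>v (a @\<^sub>v b) = a @\<^sub>v b" using abc by simp
    finally have "mat_powr ?H2 (-1/2) *\<^sub>v u = a @\<^sub>v b" .
    hence Mu: "?M *\<^sub>v u = mat_powr ?H1 (1/2) *\<^sub>v (a @\<^sub>v b)"
      using assoc_mult_mat_vec[OF pc[OF H1] pc[OF H2] uc] by simp
    have diff: "a + (?c \<cdot>\<^sub>m B1) *\<^sub>v b = ?c \<cdot>\<^sub>v ((B1 - B2) *\<^sub>v b)"
      unfolding a_def minus_mult_distrib_mat_vec[OF B1 B2 b] smult_mat_mult_vec[OF B1 b]
        smult_mat_mult_vec[OF B2 b] using B1 B2
      by (intro eq_vecI) (auto simp: algebra_simps)
    have Db: "(B1 - B2) *\<^sub>v b \<in> carrier_vec m"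
      using B2 b by (intro mult_mat_vec_carrier[of _ m m] minus_carrier_mat)
    have "(P1 * (B1 - B2) * R2') *\<^sub>v v = P1 *\<^sub>v ((B1 - B2) *\<^sub>v b)"
      unfolding b_def
      by (simp only: assoc_mult_mat_vec[OF mult_carrier_mat[OF Pc(1) minus_carrier_mat[OF B2]] R2'(1) v]
          assoc_mult_mat_vec[OF Pc(1) minus_carrier_mat[OF B2] b[unfolded b_def]])
    hence "r * cvec_norm ((P1 * (B1 - B2) * R2') *\<^sub>v v) = cvec_norm (P1 *\<^sub>v (a + (?c \<cdot>\<^sub>m B1) *\<^sub>v b))"
      unfolding diff using r Db Pc by (simp add: mult_mat_vec[of _ m m] cvec_norm_smult)
    also have "\<dots> \<le> cvec_norm (?M *\<^sub>v u)"
      unfolding Mu by (rule power2_le_imp_le)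
        (simp_all add: cvec_norm_sqrt_block_gram[OF P1 R1 cB1 a b])
    also have "\<dots> \<le> mat_opnorm ?M" using Mc uc u1 by (intro cvec_norm_le_mat_opnorm) auto
    finally show "cvec_norm ((P1 * (B1 - B2) * R2') *\<^sub>v v) \<le> mat_opnorm ?M / r"
      using r by (simp add: field_simps)
  qed
  thus ?thesis using r by (simp add: field_simps)
qed

section \<open>Measurability of matrix powers\<close>

lemma unitary_conj_index:
  assumes "unitary_mat n P" "i < n" "j < n"
  shows "unitary_conj n P f $$ (i, j) = (\<Sum>k<n. P $$ (i, k) * complex_of_real (f k) * cnj (P $$ (j, k)))"
proof -
  have P: "P \<in> carrier_mat n n" "mat_adjoint P \<in> carrier_mat n n" using assms by (auto simp: unitary_mat_def)
  define M where "M = P * mat_diag n (\<lambda>i. complex_of_real (f i))"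
  have M: "M \<in> carrier_mat n n" unfolding M_def by (rule mult_carrier_mat[OF P(1) mat_diag_dim])
  have "unitary_conj n P f $$ (i, j) = (M * mat_adjoint P) $$ (i, j)" by (simp add: unitary_conj_def M_def)
  also have "\<dots> = (\<Sum>k<n. M $$ (i, k) * mat_adjoint P $$ (k, j))"
    using M P assms(2,3) by (auto simp: scalar_prod_def lessThan_atLeast0)
  also have "\<dots> = (\<Sum>k<n. P $$ (i, k) * complex_of_real (f k) * cnj (P $$ (j, k)))"
    using P assms(2,3) unfolding M_def mat_diag_mult_right[OF P(1)] by (intro sum.cong) auto
  finally show ?thesis .
qed

lemma unitary_conj_power:
  assumes "unitary_mat n P"
  shows "unitary_conj n P f ^\<^sub>m k = unitary_conj n P (\<lambda>i. f i ^ k)"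
proof (induction k)
  case 0
  have "P \<in> carrier_mat n n" using assms by (auto simp: unitary_mat_def)
  hence "dim_row (unitary_conj n P f) = n" by (simp add: unitary_conj_def)
  thus ?case using unitary_conj_one[OF assms] by simp
next
  case (Suc k)
  thus ?case by (simp add: unitary_conj_mult[OF assms] mult.commute)
qed

text \<open>The \<open>k\<close>-th polynomial is \<open>1/(k+1)\<close>-close to \<open>t powr s\<close> on \<open>{1/(k+1)..k+1}\<close>, so one sequence
  of polynomials serves all positive definite matrices of all sizes.\<close>
lemma ex_polynomials_tendsto_powr:
  fixes s :: real
  shows "\<exists>c N. \<forall>t>0. (\<lambda>k. \<Sum>i\<le>N k. c k i * t ^ i) \<longlonglongrightarrow> t powr s"
proof -
  have "\<exists>c n. \<forall>t\<in>{1 / real (Suc k)..real (Suc k)}. \<bar>t powr s - (\<Sum>i\<le>n. c i * t ^ i)\<bar> < 1 / real (Suc k)"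
    for k :: nat
  proof -
    have "continuous_on {1 / real (Suc k)..real (Suc k)} (\<lambda>t. t powr s)"
    proof (intro continuous_intros ballI)
      fix t assume "t \<in> {1 / real (Suc k)..real (Suc k)}"
      moreover have "0 < 1 / real (Suc k)" by simp
      ultimately show "t \<noteq> 0" by (metis atLeastAtMost_iff not_le)
    qed
    then obtain g where g: "real_polynomial_function g"
      "\<And>t. t \<in> {1 / real (Suc k)..real (Suc k)} \<Longrightarrow> \<bar>t powr s - g t\<bar> < 1 / real (Suc k)"
      using Stone_Weierstrass_real_polynomial_function[of "{1 / real (Suc k)..real (Suc k)}"
          "\<lambda>t. t powr s" "1 / real (Suc k)"] by (metis compact_Icc of_nat_0_less_iff zero_less_Suc zero_less_divide_1_iff)
    from g(1) obtain c n where "g = (\<lambda>t. \<Sum>i\<le>n. c i * t ^ i)"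
      unfolding real_polynomial_function_iff_sum by blast
    thus ?thesis using g(2) by (intro exI[of _ c] exI[of _ n]) auto
  qed
  then obtain c N where cN: "\<And>k t. t \<in> {1 / real (Suc k)..real (Suc k)} \<Longrightarrow>
      \<bar>t powr s - (\<Sum>i\<le>N k. c k i * t ^ i)\<bar> < 1 / real (Suc k)"
    by metis
  have "(\<lambda>k. \<Sum>i\<le>N k. c k i * t ^ i) \<longlonglongrightarrow> t powr s" if t: "t > 0" for t
  proof (rule LIM_zero_cancel, rule Lim_null_comparison)
    obtain k0 :: nat where k0: "max t (1 / t) < real k0" using reals_Archimedean2 by blast
    show "\<forall>\<^sub>F k in sequentially. norm ((\<Sum>i\<le>N k. c k i * t ^ i) - t powr s) \<le> 1 / real (Suc k)"
    proof (rule eventually_sequentiallyI[of k0])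
      fix k assume k: "k0 \<le> k"
      hence "t \<le> real (Suc k)" "1 / t \<le> real (Suc k)" using k0 by auto
      hence "t \<in> {1 / real (Suc k)..real (Suc k)}" using t by (simp add: field_simps)
      from cN[OF this] show "norm ((\<Sum>i\<le>N k. c k i * t ^ i) - t powr s) \<le> 1 / real (Suc k)"
        by (simp add: abs_minus_commute less_imp_le)
    qed
    show "(\<lambda>k. 1 / real (Suc k)) \<longlonglongrightarrow> 0" by (rule LIMSEQ_Suc[OF lim_1_over_n])
  qed
  thus ?thesis by blast
qed

text \<open>A polynomial in \<open>A\<close> acts on the eigenvalues alone, so polynomials
  approximating \<open>powr\<close> approximate every entry of the power. Their coefficients do not
  depend on \<open>A\<close>: the entries of a power become pointwise limits of fixed polynomials in
  \<open>A\<close>, which gives measurability without a measurable choice of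
  diagonalization.\<close>

lemma mat_powr_limit:
  fixes s :: real
  shows "\<exists>c N. \<forall>n A i j. pos_def_mat n A \<longrightarrow> i < n \<longrightarrow> j < n \<longrightarrow>
    (\<lambda>k. \<Sum>l\<le>N k. complex_of_real (c k l) * (A ^\<^sub>m l) $$ (i, j)) \<longlonglongrightarrow> mat_powr A s $$ (i, j)"
proof -
  obtain c N where cN: "\<And>t. t > 0 \<Longrightarrow> (\<lambda>k. \<Sum>i\<le>N k. c k i * t ^ i) \<longlonglongrightarrow> t powr s"
    using ex_polynomials_tendsto_powr by metis
  have "(\<lambda>k. \<Sum>l\<le>N k. complex_of_real (c k l) * (A ^\<^sub>m l) $$ (i, j)) \<longlonglongrightarrow> mat_powr A s $$ (i, j)"
    if A: "pos_def_mat n A" and ij: "i < n" "j < n" for n A i j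
  proof -
    obtain P d where P: "unitary_mat n P" and d: "\<forall>i<n. 0 < d i" and Aeq: "A = unitary_conj n P d"
      using pos_def_mat_diagonalization[OF A] by blast
    have "(\<Sum>l\<le>N k. complex_of_real (c k l) * (A ^\<^sub>m l) $$ (i, j)) =
        (\<Sum>e<n. P $$ (i, e) * complex_of_real (\<Sum>l\<le>N k. c k l * d e ^ l) * cnj (P $$ (j, e)))" for k
    proof -
      have "(\<Sum>l\<le>N k. complex_of_real (c k l) * (A ^\<^sub>m l) $$ (i, j)) =
          (\<Sum>l\<le>N k. \<Sum>e<n. complex_of_real (c k l) * (P $$ (i, e) * complex_of_real (d e ^ l) * cnj (P $$ (j, e))))"
        unfolding Aeq unitary_conj_power[OF P] unitary_conj_index[OF P ij] by (simp add: sum_distrib_left)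
      also have "\<dots> = (\<Sum>e<n. \<Sum>l\<le>N k. complex_of_real (c k l) * (P $$ (i, e) * complex_of_real (d e ^ l) * cnj (P $$ (j, e))))"
        by (rule sum.swap)
      also have "\<dots> = (\<Sum>e<n. P $$ (i, e) * complex_of_real (\<Sum>l\<le>N k. c k l * d e ^ l) * cnj (P $$ (j, e)))"
        by (simp add: sum_distrib_left sum_distrib_right ac_simps)
      finally show ?thesis .
    qed
    moreover have "(\<lambda>k. \<Sum>e<n. P $$ (i, e) * complex_of_real (\<Sum>l\<le>N k. c k l * d e ^ l) * cnj (P $$ (j, e)))
        \<longlonglongrightarrow> (\<Sum>e<n. P $$ (i, e) * complex_of_real (d e powr s) * cnj (P $$ (j, e)))"
      using d by (intro tendsto_intros cN) auto
    ultimately show ?thesis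
      unfolding Aeq mat_powr_unitary_conj[OF P d] unitary_conj_index[OF P ij] by simp
  qed
  thus ?thesis by blast
qed

section \<open>Measurable matrix-valued functions\<close>

lemma measurable_mat_carrier: "measurable_mat n A \<Longrightarrow> A x \<in> carrier_mat n n"
  by (simp add: measurable_mat_def)

lemma measurable_matD: "measurable_mat n A \<Longrightarrow> i < n \<Longrightarrow> j < n \<Longrightarrow> (\<lambda>x. A x $$ (i, j)) \<in> borel_measurable lebesgue"
  by (simp add: measurable_mat_def)

lemma measurable_mat_mult:
  assumes A: "measurable_mat n A" and B: "measurable_mat n B"
  shows "measurable_mat n (\<lambda>x. A x * B x)"
  unfolding measurable_mat_def
proof (intro conjI allI impI)
  note c = measurable_mat_carrier[OF A] measurable_mat_carrier[OF B]
  show "A x * B x \<in> carrier_mat n n" for x using c[of x] by auto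
  fix i j assume ij: "i < n" "j < n"
  have "(A x * B x) $$ (i, j) = (\<Sum>k<n. A x $$ (i, k) * B x $$ (k, j))" for x
    using c[of x] ij by (auto simp: scalar_prod_def lessThan_atLeast0)
  thus "(\<lambda>x. (A x * B x) $$ (i, j)) \<in> borel_measurable lebesgue"
    using ij by (simp, intro borel_measurable_sum borel_measurable_times measurable_matD[OF A] measurable_matD[OF B]) auto
qed

lemma measurable_mat_const: "A \<in> carrier_mat n n \<Longrightarrow> measurable_mat n (\<lambda>x. A)"
  by (simp add: measurable_mat_def)

lemma measurable_mat_smult:
  assumes A: "measurable_mat n A"
  shows "measurable_mat n (\<lambda>x. c \<cdot>\<^sub>m A x)"
  unfolding measurable_mat_def
proof (intro conjI allI impI)
  show "c \<cdot>\<^sub>m A x \<in> carrier_mat n n" for x using measurable_mat_carrier[OF A, of x] by auto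
  fix i j assume ij: "i < n" "j < n"
  have "(c \<cdot>\<^sub>m A x) $$ (i, j) = c * A x $$ (i, j)" for x using measurable_mat_carrier[OF A, of x] ij by auto
  thus "(\<lambda>x. (c \<cdot>\<^sub>m A x) $$ (i, j)) \<in> borel_measurable lebesgue"
    using measurable_matD[OF A ij] by simp
qed

lemma measurable_mat_adjoint:
  assumes A: "measurable_mat n A"
  shows "measurable_mat n (\<lambda>x. mat_adjoint (A x))"
  unfolding measurable_mat_def
proof (intro conjI allI impI)
  show "mat_adjoint (A x) \<in> carrier_mat n n" for x using measurable_mat_carrier[OF A, of x] by auto
  fix i j assume ij: "i < n" "j < n"
  have "mat_adjoint (A x) $$ (i, j) = cnj (A x $$ (j, i))" for x using measurable_mat_carrier[OF A, of x] ij by auto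
  moreover have "(\<lambda>x. cnj (A x $$ (j, i))) \<in> borel_measurable lebesgue"
    by (rule borel_measurable_continuous_on[OF _ measurable_matD[OF A ij(2,1)]]) (intro continuous_intros)
  ultimately show "(\<lambda>x. mat_adjoint (A x) $$ (i, j)) \<in> borel_measurable lebesgue" by simp
qed

lemma measurable_mat_four_block_mat:
  assumes A: "measurable_mat n A" and B: "measurable_mat n B" and C: "measurable_mat n C" and E: "measurable_mat n E"
  shows "measurable_mat (n + n) (\<lambda>x. four_block_mat (A x) (B x) (C x) (E x))"
  unfolding measurable_mat_def
proof (intro conjI allI impI)
  note c = measurable_mat_carrier[OF A] measurable_mat_carrier[OF B] measurable_mat_carrier[OF C] measurable_mat_carrier[OF E]
  show "four_block_mat (A x) (B x) (C x) (E x) \<in> carrier_mat (n + n) (n + n)" for x using c[of x] by auto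
  fix i j assume ij: "i < n + n" "j < n + n"
  have "four_block_mat (A x) (B x) (C x) (E x) $$ (i, j) =
      (if i < n then if j < n then A x $$ (i, j) else B x $$ (i, j - n)
       else if j < n then C x $$ (i - n, j) else E x $$ (i - n, j - n))" for x
    using c[of x] ij by (subst index_mat_four_block) auto
  thus "(\<lambda>x. four_block_mat (A x) (B x) (C x) (E x) $$ (i, j)) \<in> borel_measurable lebesgue"
    using ij by (cases "i < n"; cases "j < n")
      (auto intro!: measurable_matD[OF A] measurable_matD[OF B] measurable_matD[OF C] measurable_matD[OF E])
qed

lemma measurable_mat_pow:
  assumes A: "measurable_mat n A"
  shows "measurable_mat n (\<lambda>x. A x ^\<^sub>m k)"
proof (induction k)
  case 0
  have "dim_row (A x) = n" for x using measurable_mat_carrier[OF A, of x] by simp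
  thus ?case by (simp add: measurable_mat_const)
qed (simp add: measurable_mat_mult A)

text \<open>Where \<open>A x\<close> is not positive definite, neither the limit nor the power has a
  meaning; completeness of Lebesgue measure absorbs this null set.\<close>

lemma borel_measurable_mat_powr:
  fixes A :: "'a::euclidean_space \<Rightarrow> complex mat"
  assumes A: "measurable_mat n A" and pos: "AE x in lebesgue. pos_def_mat n (A x)" and ij: "i < n" "j < n"
  shows "(\<lambda>x. mat_powr (A x) s $$ (i, j)) \<in> borel_measurable lebesgue"
proof -
  obtain c N where cN: "\<forall>n A i j. pos_def_mat n A \<longrightarrow> i < n \<longrightarrow> j < n \<longrightarrow>
    (\<lambda>k. \<Sum>l\<le>N k. complex_of_real (c k l) * (A ^\<^sub>m l) $$ (i, j)) \<longlonglongrightarrow> mat_powr A s $$ (i, j)"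
    using mat_powr_limit[of s] by (elim exE)
  define u where "u k x = (\<Sum>l\<le>N k. complex_of_real (c k l) * (A x ^\<^sub>m l) $$ (i, j))" for k x
  have "(\<lambda>x. lim (\<lambda>k. u k x)) \<in> borel_measurable lebesgue"
    unfolding u_def
    by (intro borel_measurable_lim_metric borel_measurable_sum borel_measurable_times
        measurable_matD[OF measurable_mat_pow[OF A] ij]) auto
  moreover have "AE x in lebesgue. lim (\<lambda>k. u k x) = mat_powr (A x) s $$ (i, j)"
    using pos by eventually_elim (auto simp: u_def intro!: limI cN[rule_format] ij)
  ultimately show ?thesis by (rule borel_measurable_AE)
qed

text \<open>Positive definiteness is assumed everywhere here because \<open>measurable_mat\<close>
  fixes the dimensions at every point, and an unspecified power might not have them.\<close>

lemma measurable_mat_powr: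
  assumes "measurable_mat n A" "\<And>x. pos_def_mat n (A x)"
  shows "measurable_mat n (\<lambda>x. mat_powr (A x) s)"
  using assms borel_measurable_mat_powr[OF assms(1)] pos_def_mat_carrier[OF pos_def_mat_powr[OF assms(2)]]
  by (auto simp: measurable_mat_def)

lemma pos_def_one: "pos_def_mat n (1\<^sub>m n)"
proof -
  have u: "unitary_mat n (1\<^sub>m n)" by (rule unitary_matI) auto
  show ?thesis using pos_def_unitary_conj[OF u, of "\<lambda>_. 1"] unitary_conj_one[OF u] by simp
qed

text \<open>The value \<open>1\<^sub>m n\<close> on the exceptional null set makes the function positive definite everywhere,
  since \<^const>\<open>mat_powr\<close> is unspecified there.\<close>
definition weight_root :: "nat \<Rightarrow> real \<Rightarrow> ('a::euclidean_space \<Rightarrow> complex mat) \<Rightarrow> 'a \<Rightarrow> complex mat" where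
  "weight_root n s W x = (if pos_def_mat n (W x) then mat_powr (W x) s else 1\<^sub>m n)"

lemma pos_def_weight_root: "pos_def_mat n (weight_root n s W x)"
  by (simp add: weight_root_def pos_def_mat_powr pos_def_one)

lemma weight_root_AE:
  "matrix_weight n W \<Longrightarrow> AE x in lebesgue. mat_powr (W x) s = weight_root n s W x"
  by (auto simp: matrix_weight_def weight_root_def)

lemma measurable_weight_root:
  assumes W: "matrix_weight n W"
  shows "measurable_mat n (weight_root n s W)"
  unfolding measurable_mat_def
proof (intro conjI allI impI)
  show "weight_root n s W x \<in> carrier_mat n n" for x by (rule pos_def_mat_carrier[OF pos_def_weight_root])
  fix i j assume ij: "i < n" "j < n"
  have "(\<lambda>x. mat_powr (W x) s $$ (i, j)) \<in> borel_measurable lebesgue"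
    using W ij by (intro borel_measurable_mat_powr) (auto simp: matrix_weight_def)
  moreover have "AE x in lebesgue. mat_powr (W x) s $$ (i, j) = weight_root n s W x $$ (i, j)"
    using weight_root_AE[OF W, of s] by eventually_elim simp
  ultimately show "(\<lambda>x. weight_root n s W x $$ (i, j)) \<in> borel_measurable lebesgue"
    by (rule borel_measurable_AE)
qed

text \<open>Integrability is given on compact sets only, so each entry is obtained as the limit of
  its truncations to growing balls.\<close>

lemma measurable_mat_locally_integrable:
  fixes B :: "'a::euclidean_space \<Rightarrow> complex mat"
  assumes B: "locally_integrable_mat n B"
  shows "measurable_mat n B"
  unfolding measurable_mat_def
proof (intro conjI allI impI)
  show "B x \<in> carrier_mat n n" for x using B by (simp add: locally_integrable_mat_def)
  fix i j assume ij: "i < n" "j < n"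
  have "(\<lambda>x. indicator (cball 0 (real k)) x *\<^sub>R B x $$ (i, j)) \<in> borel_measurable lebesgue" for k :: nat
    using B ij by (intro borel_measurable_integrable) (auto simp: locally_integrable_mat_def set_integrable_def)
  thus "(\<lambda>x. B x $$ (i, j)) \<in> borel_measurable lebesgue"
  proof (rule borel_measurable_LIMSEQ_metric)
    fix x :: 'a
    obtain k0 :: nat where "norm x \<le> real k0" using real_arch_simple by blast
    hence "\<forall>\<^sub>F k in sequentially. indicator (cball 0 (real k)) x *\<^sub>R B x $$ (i, j) = B x $$ (i, j)"
      by (intro eventually_sequentiallyI[of k0]) (auto simp: indicator_def)
    thus "(\<lambda>k. indicator (cball 0 (real k)) x *\<^sub>R B x $$ (i, j)) \<longlonglongrightarrow> B x $$ (i, j)"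
      by (rule tendsto_eventually)
  qed
qed

section \<open>Measurable vector-valued functions\<close>

definition measurable_cvec :: "nat \<Rightarrow> ('a::euclidean_space \<Rightarrow> complex vec) \<Rightarrow> bool" where
  "measurable_cvec n f \<longleftrightarrow> (\<forall>x. f x \<in> carrier_vec n) \<and> (\<forall>i<n. (\<lambda>x. f x $ i) \<in> borel_measurable lebesgue)"

lemma measurable_cvec_carrier: "measurable_cvec n f \<Longrightarrow> f x \<in> carrier_vec n"
  by (simp add: measurable_cvec_def)

lemma measurable_cvec_mult_mat_vec:
  assumes A: "measurable_mat n A" and f: "measurable_cvec n f"
  shows "measurable_cvec n (\<lambda>x. A x *\<^sub>v f x)"
  unfolding measurable_cvec_def
proof (intro conjI allI impI)
  note c = measurable_mat_carrier[OF A] measurable_cvec_carrier[OF f]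
  show "A x *\<^sub>v f x \<in> carrier_vec n" for x using c[of x] by auto
  fix i assume i: "i < n"
  have "(A x *\<^sub>v f x) $ i = (\<Sum>k<n. A x $$ (i, k) * f x $ k)" for x
    using c[of x] i by (auto simp: scalar_prod_def lessThan_atLeast0)
  thus "(\<lambda>x. (A x *\<^sub>v f x) $ i) \<in> borel_measurable lebesgue"
    using i f by (simp, intro borel_measurable_sum borel_measurable_times measurable_matD[OF A])
      (auto simp: measurable_cvec_def)
qed

lemma measurable_cvec_diff:
  assumes f: "measurable_cvec n f" and g: "measurable_cvec n g"
  shows "measurable_cvec n (\<lambda>x. f x - g x)"
  unfolding measurable_cvec_def
proof (intro conjI allI impI)
  note c = measurable_cvec_carrier[OF f] measurable_cvec_carrier[OF g]
  show "f x - g x \<in> carrier_vec n" for x using c[of x] by auto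
  fix i assume i: "i < n"
  have "(f x - g x) $ i = f x $ i - g x $ i" for x using c[of x] i by auto
  moreover have "(\<lambda>x. f x $ i - g x $ i) \<in> borel_measurable lebesgue"
    using i f g unfolding measurable_cvec_def by (intro borel_measurable_diff) auto
  ultimately show "(\<lambda>x. (f x - g x) $ i) \<in> borel_measurable lebesgue" by simp
qed

lemma borel_measurable_cvec_norm:
  assumes f: "measurable_cvec n f"
  shows "(\<lambda>x. cvec_norm (f x)) \<in> borel_measurable lebesgue"
proof -
  have "dim_vec (f x) = n" for x using measurable_cvec_carrier[OF f, of x] by simp
  moreover have "(\<lambda>x. f x $ i) \<in> borel_measurable lebesgue" if "i < n" for i
    using f that by (simp add: measurable_cvec_def)
  hence "(\<lambda>x. sqrt (\<Sum>i<n. (cmod (f x $ i))\<^sup>2)) \<in> borel_measurable lebesgue"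
    by measurable
  ultimately show ?thesis by (simp add: cvec_norm_def)
qed

section \<open>Powers, averages and \<open>L\<^sup>r\<close> norms in the extended nonnegative reals\<close>

lemma ennreal_rpow_ennreal: "0 \<le> x \<Longrightarrow> ennreal_rpow (ennreal x) r = ennreal (x powr r)"
  by (simp add: ennreal_rpow_def)

lemma ennreal_rpow_top [simp]: "ennreal_rpow top_class.top r = top_class.top"
  by (simp add: ennreal_rpow_def)

lemma ennreal_rpow_mono:
  assumes "x \<le> y" "0 < r"
  shows "ennreal_rpow x r \<le> ennreal_rpow y r"
proof (cases y)
  case y: (real y')
  with assms(1) obtain x' where x: "x = ennreal x'" "0 \<le> x'" by (cases x) (auto simp: top_unique)
  with assms y have "x' \<le> y'" by simp
  thus ?thesis using x y assms(2) by (simp add: ennreal_rpow_ennreal powr_mono2 ennreal_leI)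
next
  case top
  thus ?thesis by (simp add: ennreal_rpow_def)
qed

lemma ennreal_rpow_rpow: "ennreal_rpow (ennreal_rpow x a) b = ennreal_rpow x (a * b)"
proof (cases x)
  case (real x')
  thus ?thesis by (simp add: ennreal_rpow_ennreal powr_powr)
next
  case top
  thus ?thesis by (simp add: ennreal_rpow_def)
qed

lemma ennreal_rpow_one [simp]: "ennreal_rpow x 1 = x"
proof (cases x)
  case (real x')
  thus ?thesis by (simp add: ennreal_rpow_ennreal)
next
  case top
  thus ?thesis by (simp add: ennreal_rpow_def)
qed

lemma ennreal_rpow_cmult:
  assumes c: "0 < c"
  shows "ennreal_rpow (ennreal c * x) r = ennreal (c powr r) * ennreal_rpow x r"
proof (cases x)
  case (real x')
  hence "ennreal_rpow (ennreal c * x) r = ennreal ((c * x') powr r)"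
    using c by (subst ennreal_rpow_ennreal[symmetric]) (auto simp: ennreal_mult)
  thus ?thesis using real c by (simp add: ennreal_rpow_ennreal powr_mult ennreal_mult)
next
  case top
  moreover have "ennreal c * top_class.top = top_class.top" "ennreal (c powr r) * top_class.top = top_class.top"
    using c by (simp_all add: ennreal_mult_top)
  ultimately show ?thesis by simp
qed

text \<open>Unlike \<open>nn_integral_cmult\<close>, this needs no measurability of \<open>f\<close>; it is applied to averages that are
  not known to be measurable.\<close>
lemma nn_integral_cmult_le:
  assumes c: "0 < c"
  shows "ennreal c * integral\<^sup>N M f \<le> (\<integral>\<^sup>+x. ennreal c * f x \<partial>M)"
proof -
  have "ennreal c * integral\<^sup>N M f = (SUP g\<in>{g. simple_function M g \<and> g \<le> f}. ennreal c * integral\<^sup>S M g)"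
    unfolding nn_integral_def by (rule SUP_mult_left_ennreal)
  also have "\<dots> \<le> (\<integral>\<^sup>+x. ennreal c * f x \<partial>M)"
  proof (rule SUP_least, safe)
    fix g assume g: "simple_function M g" "g \<le> f"
    have "ennreal c * integral\<^sup>S M g = (\<integral>\<^sup>Sx. ennreal c * g x \<partial>M)" using g by simp
    also have "\<dots> \<le> (\<integral>\<^sup>+x. ennreal c * f x \<partial>M)"
      unfolding nn_integral_def using g by (intro SUP_upper) (auto simp: le_fun_def intro!: mult_left_mono)
    finally show "ennreal c * integral\<^sup>S M g \<le> (\<integral>\<^sup>+x. ennreal c * f x \<partial>M)" .
  qed
  finally show ?thesis .
qed

lemma average_cmult_le:
  assumes c: "0 < c"
  shows "ennreal c * average Q g \<le> average Q (\<lambda>x. ennreal c * g x)"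
  unfolding average_def ennreal_times_divide using nn_integral_cmult_le[OF c, of lebesgue "\<lambda>x. g x * indicator Q x"]
  by (intro divide_right_mono_ennreal) (simp add: mult.assoc)

lemma average_mono_AE:
  assumes "AE x in lebesgue. g x \<le> h x"
  shows "average Q g \<le> average Q h"
  unfolding average_def
  by (intro divide_right_mono_ennreal nn_integral_mono_AE)
    (use assms in \<open>eventually_elim, auto intro!: mult_right_mono\<close>)

section \<open>Scalar L^r norms and the limit in r\<close>

definition Lnorm :: "real \<Rightarrow> ('a::euclidean_space \<Rightarrow> real) \<Rightarrow> ennreal" where
  "Lnorm r h = ennreal_rpow (\<integral>\<^sup>+x. ennreal (h x powr r) \<partial>lebesgue) (1/r)"

lemma wnorm_Lnorm: "wnorm r W f = Lnorm r (\<lambda>x. cvec_norm (mat_powr (W x) (1/r) *\<^sub>v f x))"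
  by (simp add: wnorm_def Lnorm_def)

lemma Lnorm_mono_AE:
  assumes "AE x in lebesgue. 0 \<le> g x \<and> g x \<le> h x" "0 < r"
  shows "Lnorm r g \<le> Lnorm r h"
  unfolding Lnorm_def
  by (intro ennreal_rpow_mono nn_integral_mono_AE)
    (use assms in \<open>auto intro!: ennreal_leI powr_mono2\<close>)

lemma Lnorm_cong_AE:
  assumes "AE x in lebesgue. g x = h x"
  shows "Lnorm r g = Lnorm r h"
  unfolding Lnorm_def by (intro arg_cong2[where f = ennreal_rpow] nn_integral_cong_AE) (use assms in auto)

lemma Lnorm_cmult:
  assumes c: "0 < c" and r: "0 < r" and h: "\<And>x. 0 \<le> h x" "h \<in> borel_measurable lebesgue"
  shows "Lnorm r (\<lambda>x. c * h x) = ennreal c * Lnorm r h"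
proof -
  have "(\<integral>\<^sup>+x. ennreal ((c * h x) powr r) \<partial>lebesgue) = (\<integral>\<^sup>+x. ennreal (c powr r) * ennreal (h x powr r) \<partial>lebesgue)"
    using c h by (simp add: powr_mult ennreal_mult)
  also have "\<dots> = ennreal (c powr r) * (\<integral>\<^sup>+x. ennreal (h x powr r) \<partial>lebesgue)"
    using h by (intro nn_integral_cmult) measurable
  finally show ?thesis using c r by (simp add: Lnorm_def ennreal_rpow_cmult powr_powr)
qed

text \<open>The power of a sum of three terms is at most 3^r times the sum of their powers, and each
  of the three integrals is at most S^r. The root of the resulting factor is 3 times 3^{1/r}, which
  is at most 9 as r \<ge> 1. The loss against Minkowski's inequality only enters the final
  constant.\<close>

lemma Lnorm_add3_le:
  assumes r: "1 \<le> r"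
    and a: "\<And>x. 0 \<le> a x" "a \<in> borel_measurable lebesgue"
    and b: "\<And>x. 0 \<le> b x" "b \<in> borel_measurable lebesgue"
    and c: "\<And>x. 0 \<le> c x" "c \<in> borel_measurable lebesgue"
  shows "Lnorm r (\<lambda>x. a x + b x + c x) \<le> 9 * (Lnorm r a + Lnorm r b + Lnorm r c)"
proof -
  define S where "S = Lnorm r a + Lnorm r b + Lnorm r c"
  let ?I = "\<lambda>h. \<integral>\<^sup>+x. ennreal (h x powr r) \<partial>lebesgue"
  have I: "?I h \<le> ennreal_rpow S r" if "Lnorm r h \<le> S" for h
  proof -
    have "1 / r * r = 1" using r by simp
    hence "?I h = ennreal_rpow (Lnorm r h) r" unfolding Lnorm_def ennreal_rpow_rpow by simp
    also have "\<dots> \<le> ennreal_rpow S r" using that r by (intro ennreal_rpow_mono) auto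
    finally show ?thesis .
  qed
  have pt: "(u + v + w) powr r \<le> 3 powr r * (u powr r + v powr r + w powr r)"
    if "0 \<le> u" "0 \<le> v" "0 \<le> w" for u v w :: real
  proof -
    let ?m = "max u (max v w)"
    have "(u + v + w) powr r \<le> (3 * ?m) powr r" using that r by (intro powr_mono2) auto
    also have "\<dots> = 3 powr r * ?m powr r" using that by (subst powr_mult) auto
    also have "?m powr r \<le> u powr r + v powr r + w powr r" by (auto simp: max_def)
    finally show ?thesis by simp
  qed
  have "?I (\<lambda>x. a x + b x + c x) \<le>
      (\<integral>\<^sup>+x. ennreal (3 powr r) * (ennreal (a x powr r) + ennreal (b x powr r) + ennreal (c x powr r)) \<partial>lebesgue)"
  proof (rule nn_integral_mono)
    fix x
    have "ennreal (3 powr r) * (ennreal (a x powr r) + ennreal (b x powr r) + ennreal (c x powr r)) =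
        ennreal (3 powr r * (a x powr r + b x powr r + c x powr r))"
      by (simp add: ennreal_mult ennreal_plus)
    thus "ennreal ((a x + b x + c x) powr r) \<le>
        ennreal (3 powr r) * (ennreal (a x powr r) + ennreal (b x powr r) + ennreal (c x powr r))"
      using pt[OF a(1) b(1) c(1), of x x x] by (simp only: ennreal_leI)
  qed
  also have "\<dots> = ennreal (3 powr r) * (?I a + ?I b + ?I c)"
  proof -
    have [measurable]: "(\<lambda>x. ennreal (h x powr r)) \<in> borel_measurable lebesgue"
      if "h \<in> borel_measurable lebesgue" for h :: "'a \<Rightarrow> real"
      using that by measurable
    note [measurable] = a(2) b(2) c(2)
    show ?thesis by (simp add: nn_integral_cmult nn_integral_add)
  qed
  also have "\<dots> \<le> ennreal (3 powr r) * (ennreal_rpow S r + ennreal_rpow S r + ennreal_rpow S r)"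
    by (intro mult_left_mono add_mono I) (auto simp: S_def add_increasing add_increasing2)
  also have "\<dots> = ennreal (3 powr r * 3) * ennreal_rpow S r"
  proof -
    have "(1 + 1 + 1) * u = u + u + u" for u :: ennreal by (simp only: distrib_right mult_1_left)
    hence "u + u + u = 3 * u" for u :: ennreal by simp
    moreover have "ennreal (3 powr r * 3) = ennreal (3 powr r) * 3" by (simp add: ennreal_mult)
    ultimately show ?thesis by (simp only: mult.assoc)
  qed
  finally have "Lnorm r (\<lambda>x. a x + b x + c x) \<le> ennreal_rpow (ennreal (3 powr r * 3) * ennreal_rpow S r) (1/r)"
    unfolding Lnorm_def using r by (intro ennreal_rpow_mono) auto
  also have "\<dots> = ennreal ((3 powr r * 3) powr (1/r)) * S"
    using r by (subst ennreal_rpow_cmult) (auto simp: ennreal_rpow_rpow)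
  also have "(3 powr r * 3) powr (1/r) = 3 * 3 powr (1/r)" using r by (simp add: powr_mult powr_powr)
  also have "ennreal (3 * 3 powr (1/r)) * S \<le> 9 * S"
  proof (rule mult_right_mono)
    have "3 powr (1/r) \<le> (3::real) powr 1" using r by (intro powr_mono) auto
    hence "ennreal (3 * 3 powr (1/r)) \<le> ennreal 9" by (intro ennreal_leI) simp
    thus "ennreal (3 * 3 powr (1/r)) \<le> 9" by simp
  qed simp
  finally show ?thesis by (simp add: S_def)
qed

text \<open>Both sides are affine in \<open>r\<close>. If \<open>x\<close> exceeded
  \<open>K * N\<close>, the slope on the left would be the larger one, and a single large
  \<open>r\<close> would violate the hypothesis. Finiteness of \<open>t\<close> also rules out an
  infinite \<open>x\<close> when \<open>N\<close> is finite.\<close>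

lemma ennreal_le_of_scaled_le:
  assumes K: "0 < K" and t: "t < \<infinity>"
    and le: "\<And>r. 0 < r \<Longrightarrow> ennreal r * x \<le> ennreal K * (t + ennreal r * N)"
  shows "x \<le> ennreal K * N"
proof (cases N)
  case (real N')
  obtain t' where t': "t = ennreal t'" "0 \<le> t'" using t by (cases t) auto
  have fin: "ennreal K * (t + ennreal r * N) = ennreal (K * (t' + r * N'))" if "0 < r" for r
    using that K real t' by (simp flip: ennreal_mult ennreal_plus)
  show ?thesis
  proof (cases x)
    case x: (real x')
    have le': "r * x' \<le> K * (t' + r * N')" if r: "0 < r" for r
      using le[OF r] unfolding fin[OF r] using K r x real t' by (simp flip: ennreal_mult)
    have "x' \<le> K * N'"
    proof (rule ccontr)
      assume "\<not> x' \<le> K * N'"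
      hence d: "0 < x' - K * N'" by simp
      \<comment> \<open>For this value the gain \<open>r * (x' - K * N')\<close> exceeds
        \<open>K * t'\<close> by exactly 1.\<close>
      define r where "r = (K * t' + 1) / (x' - K * N')"
      have "0 < r" unfolding r_def using d K t' by (intro divide_pos_pos) (auto intro!: add_nonneg_pos)
      moreover have "r * (x' - K * N') = K * t' + 1" using d by (simp add: r_def)
      ultimately show False using le'[of r] by (simp add: algebra_simps)
    qed
    thus ?thesis using x real K by (simp flip: ennreal_mult)
  next
    case top
    thus ?thesis using le[of 1] fin[of 1] by (simp add: top_unique)
  qed
next
  case top
  thus ?thesis using K by (simp add: ennreal_mult_top)
qed

section \<open>The block weight\<close>

lemma measurable_mat_block_gram:
  assumes P: "measurable_mat m P" and B: "measurable_mat m B" and R: "measurable_mat m R"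
  shows "measurable_mat (m + m) (\<lambda>x. block_gram m (P x) (B x) (R x))"
  unfolding block_gram_def block_factor_def
  by (intro measurable_mat_mult measurable_mat_adjoint measurable_mat_four_block_mat P R
      measurable_mat_mult[OF P B] measurable_mat_const) auto

text \<open>The exponent q/2 makes the power 1/q of this weight the square root of the Gram matrix.
  The roots are taken by \<open>weight_root\<close> rather than \<open>mat_powr\<close> so that the
  weight is positive definite at every point and its powers can be computed everywhere.\<close>

definition block_weight :: "nat \<Rightarrow> real \<Rightarrow> real \<Rightarrow> ('a::euclidean_space \<Rightarrow> complex mat) \<Rightarrow>
    ('a \<Rightarrow> complex mat) \<Rightarrow> ('a \<Rightarrow> complex mat) \<Rightarrow> 'a \<Rightarrow> complex mat" where
  "block_weight m q r V B U x = mat_powr (block_gram m (weight_root m (1/q) V x)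
     (complex_of_real r \<cdot>\<^sub>m B x) (weight_root m (1/q) U x)) (q/2)"

lemma pos_def_block_gram_roots:
  assumes "measurable_mat m B"
  shows "pos_def_mat (m + m) (block_gram m (weight_root m s V x) (c \<cdot>\<^sub>m B x) (weight_root m s U x))"
  using measurable_mat_carrier[OF assms, of x]
  by (intro pos_def_block_gram pos_def_weight_root) auto

lemma pos_def_block_weight: "measurable_mat m B \<Longrightarrow> pos_def_mat (m + m) (block_weight m q r V B U x)"
  unfolding block_weight_def by (intro pos_def_mat_powr pos_def_block_gram_roots)

lemma matrix_weight_block_weight:
  assumes V: "matrix_weight m V" and U: "matrix_weight m U" and B: "measurable_mat m B"
  shows "matrix_weight (m + m) (block_weight m q r V B U)"
proof -
  have "measurable_mat (m + m) (block_weight m q r V B U)"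
    unfolding block_weight_def[abs_def]
    by (intro measurable_mat_powr measurable_mat_block_gram measurable_weight_root V U
        measurable_mat_smult B pos_def_block_gram_roots)
  thus ?thesis using pos_def_block_weight[OF B] by (simp add: matrix_weight_def)
qed

lemma mat_powr_block_weight:
  "measurable_mat m B \<Longrightarrow> mat_powr (block_weight m q r V B U x) s =
    mat_powr (block_gram m (weight_root m (1/q) V x) (complex_of_real r \<cdot>\<^sub>m B x) (weight_root m (1/q) U x)) (q/2 * s)"
  unfolding block_weight_def by (rule mat_powr_mat_powr[OF pos_def_block_gram_roots])

text \<open>The kernels are compared pointwise by \<open>mat_opnorm_block_gram_ge\<close>, and the
  factor is then carried outwards: r^{p'} from the inner average, r^q after the power q/p', and r
  after the power 1/q. The null set in y is discarded for each fixed good x, so no product measure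
  enters.\<close>

lemma bmo_norm_le_Apq_const_block_weight:
  fixes U V B :: "'a::euclidean_space \<Rightarrow> complex mat"
  assumes V: "matrix_weight m V" and U: "matrix_weight m U" and B: "measurable_mat m B"
    and p: "1 < p" and q: "1 < q" and r: "0 < r"
  shows "ennreal r * bmo_norm p q V U B \<le> ennreal_rpow (Apq_const p q (block_weight m q r V B U)) (1/q)"
proof -
  define p' where "p' = conj_exp p"
  have p': "0 < p'" using p by (simp add: p'_def conj_exp_def)
  let ?W = "block_weight m q r V B U"
  define F where "F x y = mat_opnorm (mat_powr (V x) (1/q) * (B x - B y) * mat_powr (U y) (-1/q))" for x y
  define G where "G x y = mat_opnorm (mat_powr (?W x) (1/q) * mat_powr (?W y) (-1/q))" for x y
  have FG: "r * F x y \<le> G x y" if Vx: "pos_def_mat m (V x)" and Uy: "pos_def_mat m (U y)" for x y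
  proof -
    have exps: "q / 2 * (1 / q) = 1 / 2" "q / 2 * (-1 / q) = -1 / 2" using q by auto
    have V1: "weight_root m (1/q) V x = mat_powr (V x) (1/q)" using Vx by (simp add: weight_root_def)
    have U2: "weight_root m (1/q) U y = mat_powr (U y) (1/q)" using Uy by (simp add: weight_root_def)
    have inv: "weight_root m (1/q) U y * mat_powr (U y) (-1/q) = 1\<^sub>m m"
      unfolding U2 mat_powr_add[OF Uy, symmetric] by (simp add: mat_powr_zero[OF Uy])
    show ?thesis
      unfolding F_def G_def mat_powr_block_weight[OF B] exps V1[symmetric]
      by (rule mat_opnorm_block_gram_ge[OF pos_def_weight_root pos_def_weight_root measurable_mat_carrier[OF B]
            pos_def_weight_root pos_def_weight_root measurable_mat_carrier[OF B]
            pos_def_mat_carrier[OF pos_def_mat_powr[OF Uy]] inv r])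
  qed
  have AEV: "AE x in lebesgue. pos_def_mat m (V x)" and AEU: "AE x in lebesgue. pos_def_mat m (U x)"
    using V U by (auto simp: matrix_weight_def)
  have inner: "ennreal (r powr p') * average Q (\<lambda>y. ennreal (F x y powr p')) \<le> average Q (\<lambda>y. ennreal (G x y powr p'))"
    if Vx: "pos_def_mat m (V x)" for x Q
  proof -
    have "ennreal (r powr p') * average Q (\<lambda>y. ennreal (F x y powr p')) \<le>
        average Q (\<lambda>y. ennreal (r powr p') * ennreal (F x y powr p'))"
      using r by (intro average_cmult_le) simp
    also have "\<dots> \<le> average Q (\<lambda>y. ennreal (G x y powr p'))"
    proof (rule average_mono_AE)
      show "AE y in lebesgue. ennreal (r powr p') * ennreal (F x y powr p') \<le> ennreal (G x y powr p')"
        using AEU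
      proof eventually_elim
        fix y assume "pos_def_mat m (U y)"
        from FG[OF Vx this] have "(r * F x y) powr p' \<le> G x y powr p'"
          using p' r by (intro powr_mono2) (auto simp: F_def mat_opnorm_nonneg)
        thus "ennreal (r powr p') * ennreal (F x y powr p') \<le> ennreal (G x y powr p')"
          using r by (simp add: powr_mult F_def mat_opnorm_nonneg ennreal_leI flip: ennreal_mult)
      qed
    qed
    finally show ?thesis .
  qed
  have pq: "0 < q / p'" using p' q by simp
  have outer: "ennreal (r powr q) * average Q (\<lambda>x. ennreal_rpow (average Q (\<lambda>y. ennreal (F x y powr p'))) (q/p'))
      \<le> average Q (\<lambda>x. ennreal_rpow (average Q (\<lambda>y. ennreal (G x y powr p'))) (q/p'))" for Q
  proof -
    have "ennreal (r powr q) * average Q (\<lambda>x. ennreal_rpow (average Q (\<lambda>y. ennreal (F x y powr p'))) (q/p'))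
        \<le> average Q (\<lambda>x. ennreal (r powr q) * ennreal_rpow (average Q (\<lambda>y. ennreal (F x y powr p'))) (q/p'))"
      using r by (intro average_cmult_le) simp
    also have "\<dots> \<le> average Q (\<lambda>x. ennreal_rpow (average Q (\<lambda>y. ennreal (G x y powr p'))) (q/p'))"
    proof (rule average_mono_AE)
      show "AE x in lebesgue. ennreal (r powr q) * ennreal_rpow (average Q (\<lambda>y. ennreal (F x y powr p'))) (q/p')
          \<le> ennreal_rpow (average Q (\<lambda>y. ennreal (G x y powr p'))) (q/p')"
        using AEV
      proof eventually_elim
        fix x assume "pos_def_mat m (V x)"
        from ennreal_rpow_mono[OF inner[OF this] pq]
        show "ennreal (r powr q) * ennreal_rpow (average Q (\<lambda>y. ennreal (F x y powr p'))) (q/p')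
            \<le> ennreal_rpow (average Q (\<lambda>y. ennreal (G x y powr p'))) (q/p')"
          using r p' by (simp add: ennreal_rpow_cmult powr_powr)
      qed
    qed
    finally show ?thesis .
  qed
  have "ennreal (r powr q) * (SUP Q\<in>cubes. average Q (\<lambda>x. ennreal_rpow (average Q (\<lambda>y. ennreal (F x y powr p'))) (q/p')))
      \<le> Apq_const p q ?W"
    unfolding Apq_const_def SUP_mult_left_ennreal G_def[symmetric] p'_def[symmetric]
    by (intro SUP_mono' outer)
  from ennreal_rpow_mono[OF this, of "1/q"]
  show ?thesis
    using q r by (simp add: bmo_norm_def F_def p'_def ennreal_rpow_cmult powr_powr)
qed

section \<open>The norm of T with respect to the block weight\<close>

lemma wnorm_weight_root:
  assumes "matrix_weight n W"
  shows "wnorm q W f = Lnorm q (\<lambda>x. cvec_norm (weight_root n (1/q) W x *\<^sub>v f x))"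
  unfolding wnorm_Lnorm
  by (rule Lnorm_cong_AE) (use weight_root_AE[OF assms, of "1/q"] in \<open>eventually_elim, simp\<close>)

text \<open>The exponents p/q and 1/p multiply to 1/q, so the source norm involves the same root of
  the weight as the target norm.\<close>

lemma wnorm_weight_powr:
  assumes W: "matrix_weight n W" and p: "0 < p"
  shows "wnorm p (weight_powr W (p/q)) f = Lnorm p (\<lambda>x. cvec_norm (weight_root n (1/q) W x *\<^sub>v f x))"
  unfolding wnorm_Lnorm
proof (rule Lnorm_cong_AE)
  have "AE x in lebesgue. pos_def_mat n (W x)" using W by (simp add: matrix_weight_def)
  thus "AE x in lebesgue. cvec_norm (mat_powr (weight_powr W (p/q) x) (1/p) *\<^sub>v f x) =
      cvec_norm (weight_root n (1/q) W x *\<^sub>v f x)"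
    by eventually_elim (use p in \<open>simp add: weight_powr_def mat_powr_mat_powr weight_root_def\<close>)
qed

lemma measurable_cvec_vec_dom:
  assumes T: "linear_operator D T" and f: "f \<in> vec_dom n D"
  shows "measurable_cvec n f"
proof -
  have "D \<subseteq> borel_measurable lebesgue" using T by (simp add: linear_operator_def)
  thus ?thesis using f unfolding vec_dom_def measurable_cvec_def by blast
qed

lemma measurable_cvec_vec_ext:
  assumes T: "linear_operator D T" and f: "f \<in> vec_dom n D"
  shows "measurable_cvec n (vec_ext n T f)"
proof -
  have "T u \<in> borel_measurable lebesgue" if "u \<in> D" for u using T that by (simp add: linear_operator_def)
  moreover have "(\<lambda>x. f x $ i) \<in> D" if "i < n" for i using f that by (simp add: vec_dom_def)
  ultimately have "T (\<lambda>x. f x $ i) \<in> borel_measurable lebesgue" if "i < n" for i using that by blast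
  thus ?thesis by (simp add: measurable_cvec_def vec_ext_def)
qed

lemma wnorm_le_op_norm:
  "f \<in> wLp n p W1 \<Longrightarrow> f \<in> E \<Longrightarrow> wnorm p W1 f \<le> 1 \<Longrightarrow> wnorm q W2 (S f) \<le> op_norm n p W1 q W2 E S"
  unfolding op_norm_def by (rule SUP_upper) auto

text \<open>For f = (h, k) of norm at most 1, the functions g = h + r B k and k have norm at most 1
  for the weights of V and U, so they are admissible in the suprema on the right. The target norm of
  T f is then bounded by the contributions of T g, of r times the commutator at k, and of T k; the
  constant 9 is that of \<open>Lnorm_add3_le\<close>.\<close>

lemma op_norm_block_weight_le:
  fixes U V B :: "'a::euclidean_space \<Rightarrow> complex mat"
  assumes V: "matrix_weight m V" and U: "matrix_weight m U" and B: "measurable_mat m B"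
    and lin: "linear_operator D T" and dom: "wLp m p (weight_powr V (p/q)) \<subseteq> vec_dom m D"
    and p: "1 < p" and q: "1 < q" and r: "0 < r"
  shows "op_norm (m + m) p (weight_powr (block_weight m q r V B U) (p/q)) q (block_weight m q r V B U)
      (vec_dom (m + m) D) (vec_ext (m + m) T) \<le>
    9 * (op_norm m p (weight_powr V (p/q)) q V (vec_dom m D) (vec_ext m T) +
      ennreal r * op_norm m p (weight_powr U (p/q)) q V (commutator_dom m B D) (commutator m B T) +
      op_norm m p (weight_powr U (p/q)) q U (vec_dom m D) (vec_ext m T))"
    (is "op_norm _ _ _ _ ?W _ _ \<le> 9 * (?NV + _ * ?NC + ?NU)")
  unfolding op_norm_def[of "m + m"]
proof (rule SUP_least, elim CollectE conjE IntE)
  fix f assume f: "f \<in> wLp (m + m) p (weight_powr ?W (p/q))" "f \<in> vec_dom (m + m) D"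
    and f1: "wnorm p (weight_powr ?W (p/q)) f \<le> 1"
  let ?c = "complex_of_real r"
  have W: "matrix_weight (m + m) ?W" by (rule matrix_weight_block_weight[OF V U B])
  define P where "P = weight_root m (1/q) V"
  define R where "R = weight_root m (1/q) U"
  define S where "S = weight_root (m + m) (1/q) ?W"
  have Pp: "pos_def_mat m (P x)" and Rp: "pos_def_mat m (R x)" for x by (auto simp: P_def R_def pos_def_weight_root)
  note Pc = pos_def_mat_carrier[OF Pp] and Rc = pos_def_mat_carrier[OF Rp] and Bc = measurable_mat_carrier[OF B]
  have Pm: "measurable_mat m P" and Rm: "measurable_mat m R"
    unfolding P_def R_def by (rule measurable_weight_root[OF V] measurable_weight_root[OF U])+
  have S: "(cvec_norm (S x *\<^sub>v (a @\<^sub>v b)))\<^sup>2 =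
      (cvec_norm (P x *\<^sub>v (a + ?c \<cdot>\<^sub>v (B x *\<^sub>v b))))\<^sup>2 + (cvec_norm (R x *\<^sub>v b))\<^sup>2"
    if ab: "a \<in> carrier_vec m" "b \<in> carrier_vec m" for x a b
  proof -
    have e: "q / 2 * (1 / q) = 1 / 2" using q by simp
    have "S x = mat_powr (?W x) (1/q)" unfolding S_def weight_root_def by (simp only: pos_def_block_weight[OF B] if_True)
    hence "S x = mat_powr (block_gram m (P x) (?c \<cdot>\<^sub>m B x) (R x)) (1/2)"
      by (simp only: mat_powr_block_weight[OF B] P_def R_def e)
    thus ?thesis
      using cvec_norm_sqrt_block_gram[OF Pp[of x] Rp[of x] smult_carrier_mat[OF Bc[of x], of ?c] ab]
      by (simp add: smult_mat_mult_vec[OF Bc ab(2)])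
  qed
  have fc: "f x \<in> carrier_vec (m + m)" for x using f(2) by (simp add: vec_dom_def)
  define h where "h x = vec_first (f x) m" for x
  define k where "k x = vec_last (f x) m" for x
  have hc: "h x \<in> carrier_vec m" and kc: "k x \<in> carrier_vec m" for x by (auto simp: h_def k_def)
  have hk: "f x = h x @\<^sub>v k x" for x using fc[of x] by (simp add: h_def k_def)
  have h_index: "h x $ i = f x $ i" and k_index: "k x $ i = f x $ (m + i)" if "i < m" for i x
    using that fc[of x] hc[of x] kc[of x] by (auto simp: hk)
  have fD: "(\<lambda>x. f x $ i) \<in> D" if "i < m + m" for i using f(2) that by (simp add: vec_dom_def)
  have hD: "h \<in> vec_dom m D" and kD: "k \<in> vec_dom m D"
    using fD hc kc by (auto simp: vec_dom_def h_index k_index)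
  define Bk where "Bk = mult_op B k"
  have Bk: "Bk x = B x *\<^sub>v k x" for x by (simp add: Bk_def mult_op_def)
  have Bkc: "Bk x \<in> carrier_vec m" for x unfolding Bk by (rule mult_mat_vec_carrier[OF Bc kc])
  define g where "g x = h x + ?c \<cdot>\<^sub>v Bk x" for x
  have gc: "g x \<in> carrier_vec m" for x using hc[of x] Bkc[of x] by (simp add: g_def)
  have g_index: "g x $ i = h x $ i + ?c * Bk x $ i" if "i < m" for x i
    using that hc[of x] Bkc[of x] by (simp add: g_def)
  have Sf: "(cvec_norm (S x *\<^sub>v f x))\<^sup>2 = (cvec_norm (P x *\<^sub>v g x))\<^sup>2 + (cvec_norm (R x *\<^sub>v k x))\<^sup>2" for x
    unfolding hk S[OF hc kc] g_def Bk ..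
  have Pg_le: "cvec_norm (P x *\<^sub>v g x) \<le> cvec_norm (S x *\<^sub>v f x)"
    and Rk_le: "cvec_norm (R x *\<^sub>v k x) \<le> cvec_norm (S x *\<^sub>v f x)" for x
    by (rule power2_le_imp_le; simp add: Sf)+
  have Sf1: "Lnorm p (\<lambda>x. cvec_norm (S x *\<^sub>v f x)) \<le> 1"
    using f1 p unfolding S_def by (subst wnorm_weight_powr[OF W, symmetric]) auto
  have k1: "wnorm p (weight_powr U (p/q)) k \<le> 1"
  proof -
    have "wnorm p (weight_powr U (p/q)) k = Lnorm p (\<lambda>x. cvec_norm (R x *\<^sub>v k x))"
      unfolding R_def using p by (intro wnorm_weight_powr[OF U]) auto
    also have "\<dots> \<le> Lnorm p (\<lambda>x. cvec_norm (S x *\<^sub>v f x))"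
      using p Rk_le by (intro Lnorm_mono_AE) auto
    finally show ?thesis using Sf1 by (rule order_trans)
  qed
  have g1: "wnorm p (weight_powr V (p/q)) g \<le> 1"
  proof -
    have "wnorm p (weight_powr V (p/q)) g = Lnorm p (\<lambda>x. cvec_norm (P x *\<^sub>v g x))"
      unfolding P_def using p by (intro wnorm_weight_powr[OF V]) auto
    also have "\<dots> \<le> Lnorm p (\<lambda>x. cvec_norm (S x *\<^sub>v f x))"
      using p Pg_le by (intro Lnorm_mono_AE) auto
    finally show ?thesis using Sf1 by (rule order_trans)
  qed
  have hm: "measurable_cvec m h" and km: "measurable_cvec m k"
    by (rule measurable_cvec_vec_dom[OF lin hD] measurable_cvec_vec_dom[OF lin kD])+
  have Bkm: "measurable_cvec m Bk" unfolding Bk[abs_def] by (rule measurable_cvec_mult_mat_vec[OF B km])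
  have kL: "k \<in> wLp m p (weight_powr U (p/q))"
    using k1 km by (auto simp: wLp_def measurable_cvec_def intro: le_less_trans)
  have "(\<lambda>x. g x $ i) \<in> borel_measurable lebesgue" if i: "i < m" for i
  proof -
    have "(\<lambda>x. h x $ i) \<in> borel_measurable lebesgue" "(\<lambda>x. Bk x $ i) \<in> borel_measurable lebesgue"
      using hm Bkm i by (auto simp: measurable_cvec_def)
    hence "(\<lambda>x. h x $ i + ?c * Bk x $ i) \<in> borel_measurable lebesgue" by measurable
    thus ?thesis by (simp add: g_index[OF i])
  qed
  hence gL: "g \<in> wLp m p (weight_powr V (p/q))"
    using g1 gc by (auto simp: wLp_def intro: le_less_trans)
  hence gD: "g \<in> vec_dom m D" using dom by blast
  have addD: "(\<lambda>x. u x + v x) \<in> D" if "u \<in> D" "v \<in> D" for u v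
    using lin that by (simp add: linear_operator_def)
  have multD: "(\<lambda>x. z * u x) \<in> D" if "u \<in> D" for u z
    using lin that by (simp add: linear_operator_def)
  \<comment> \<open>That \<open>g\<close> lies in the domain was read off from its norm, through the
    inclusion \<open>dom\<close>. As \<open>h\<close> lies there too and \<open>r\<close> is
    nonzero, so does \<open>Bk\<close>, the difference of the two divided by \<open>r\<close>; this
    makes the commutator defined at \<open>k\<close>.\<close>
  have BkD: "Bk \<in> vec_dom m D"
  proof -
    have "(\<lambda>x. Bk x $ i) \<in> D" if i: "i < m" for i
    proof -
      have "(\<lambda>x. g x $ i) \<in> D" "(\<lambda>x. h x $ i) \<in> D" using gD hD i by (auto simp: vec_dom_def)
      hence "(\<lambda>x. (1 / ?c) * (g x $ i + (-1) * h x $ i)) \<in> D" by (intro multD addD)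
      moreover have "(1 / ?c) * (g x $ i + (-1) * h x $ i) = Bk x $ i" for x
        using r by (simp add: g_index[OF i])
      ultimately show ?thesis by simp
    qed
    thus ?thesis using Bkc by (auto simp: vec_dom_def)
  qed
  have kC: "k \<in> commutator_dom m B D" using kD BkD by (simp add: commutator_dom_def Bk_def)
  let ?T = "vec_ext m T"
  define C where "C = commutator m B T k"
  have C: "C x = B x *\<^sub>v ?T k x - ?T Bk x" for x by (simp add: C_def commutator_def mult_op_def Bk_def)
  have Thm: "measurable_cvec m (?T h)" and Tkm: "measurable_cvec m (?T k)"
    and Tgm: "measurable_cvec m (?T g)" and TBm: "measurable_cvec m (?T Bk)"
    by (rule measurable_cvec_vec_ext[OF lin hD] measurable_cvec_vec_ext[OF lin kD]
        measurable_cvec_vec_ext[OF lin gD] measurable_cvec_vec_ext[OF lin BkD])+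
  note Tc = measurable_cvec_carrier[OF Thm] measurable_cvec_carrier[OF Tkm]
    measurable_cvec_carrier[OF Tgm] measurable_cvec_carrier[OF TBm]
  have BTm: "measurable_cvec m (\<lambda>x. B x *\<^sub>v ?T k x)" by (rule measurable_cvec_mult_mat_vec[OF B Tkm])
  note BTc = measurable_cvec_carrier[OF BTm]
  have Cm: "measurable_cvec m C" unfolding C[abs_def] by (rule measurable_cvec_diff[OF BTm TBm])
  have T_index: "?T u x $ i = T (\<lambda>y. u y $ i) x" if "i < m" for u x i using that by (simp add: vec_ext_def)
  have Tf: "vec_ext (m + m) T f x = ?T h x @\<^sub>v ?T k x" for x
    by (intro eq_vecI) (auto simp: vec_ext_def h_index k_index)
  note meas = measurable_cvec_mult_mat_vec[OF Pm Tgm, THEN borel_measurable_cvec_norm]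
    measurable_cvec_mult_mat_vec[OF Pm Cm, THEN borel_measurable_cvec_norm]
    measurable_cvec_mult_mat_vec[OF Rm Tkm, THEN borel_measurable_cvec_norm]
  \<comment> \<open>Linearity of \<open>T\<close> holds almost everywhere for each coordinate
    separately, and the finitely many null sets are united.\<close>
  have "AE x in lebesgue. \<forall>i\<in>{..<m}. ?T g x $ i = ?T h x $ i + ?c * ?T Bk x $ i"
  proof (rule AE_finite_allI)
    fix i assume "i \<in> {..<m}"
    hence i: "i < m" by simp
    have D: "(\<lambda>x. h x $ i) \<in> D" "(\<lambda>x. Bk x $ i) \<in> D" using hD BkD i by (auto simp: vec_dom_def)
    hence D': "(\<lambda>x. ?c * Bk x $ i) \<in> D" by (intro multD)
    have "AE x in lebesgue. T (\<lambda>x. h x $ i + ?c * Bk x $ i) x = T (\<lambda>x. h x $ i) x + T (\<lambda>x. ?c * Bk x $ i) x"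
      using lin D(1) D' by (simp add: linear_operator_def)
    moreover have "AE x in lebesgue. T (\<lambda>x. ?c * Bk x $ i) x = ?c * T (\<lambda>x. Bk x $ i) x"
      using lin D(2) by (simp add: linear_operator_def)
    ultimately show "AE x in lebesgue. ?T g x $ i = ?T h x $ i + ?c * ?T Bk x $ i"
      by eventually_elim (simp add: T_index[OF i] g_index[OF i])
  qed simp
  hence "AE x in lebesgue. cvec_norm (S x *\<^sub>v vec_ext (m + m) T f x) \<le>
      cvec_norm (P x *\<^sub>v ?T g x) + r * cvec_norm (P x *\<^sub>v C x) + cvec_norm (R x *\<^sub>v ?T k x)"
  proof eventually_elim
    case (elim x)
    note c = Tc(1)[of x] Tc(2)[of x] Tc(3)[of x] Tc(4)[of x] BTc[of x]
    have Cc: "C x \<in> carrier_vec m" by (rule measurable_cvec_carrier[OF Cm])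
    \<comment> \<open>The terms with T applied to \<open>Bk\<close> cancel: T g contains r times
      this function, and r times the commutator contains its negative.\<close>
    have "?T h x + ?c \<cdot>\<^sub>v (B x *\<^sub>v ?T k x) = ?T g x + ?c \<cdot>\<^sub>v C x"
      using c elim Bc[of x] unfolding C by (intro eq_vecI) (auto simp: algebra_simps)
    moreover have "P x *\<^sub>v (?T g x + ?c \<cdot>\<^sub>v C x) = P x *\<^sub>v ?T g x + ?c \<cdot>\<^sub>v (P x *\<^sub>v C x)"
      using mult_add_distrib_mat_vec[OF Pc c(3), of "?c \<cdot>\<^sub>v C x"] mult_mat_vec[OF Pc Cc] Cc by simp
    ultimately have "cvec_norm (P x *\<^sub>v (?T h x + ?c \<cdot>\<^sub>v (B x *\<^sub>v ?T k x))) \<le>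
        cvec_norm (P x *\<^sub>v ?T g x) + r * cvec_norm (P x *\<^sub>v C x)" (is "?a \<le> ?b")
      using cvec_norm_add_le[OF mult_mat_vec_carrier[OF Pc c(3)], of "?c \<cdot>\<^sub>v (P x *\<^sub>v C x)"]
        mult_mat_vec_carrier[OF Pc Cc] r by (simp add: cvec_norm_smult)
    \<comment> \<open>The root of a sum of two squares is at most the sum of the two
      numbers.\<close>
    moreover have "cvec_norm (S x *\<^sub>v vec_ext (m + m) T f x) \<le> ?a + cvec_norm (R x *\<^sub>v ?T k x)"
      by (rule power2_le_imp_le) (simp_all add: Tf S[OF c(1,2)] power2_sum)
    ultimately show ?case by linarith
  qed
  hence "wnorm q ?W (vec_ext (m + m) T f) \<le>
      Lnorm q (\<lambda>x. cvec_norm (P x *\<^sub>v ?T g x) + r * cvec_norm (P x *\<^sub>v C x) + cvec_norm (R x *\<^sub>v ?T k x))"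
    unfolding wnorm_weight_root[OF W] S_def[symmetric] using q by (intro Lnorm_mono_AE) auto
  also have "\<dots> \<le> 9 * (Lnorm q (\<lambda>x. cvec_norm (P x *\<^sub>v ?T g x)) + Lnorm q (\<lambda>x. r * cvec_norm (P x *\<^sub>v C x)) +
      Lnorm q (\<lambda>x. cvec_norm (R x *\<^sub>v ?T k x)))"
    using q r
    by (intro Lnorm_add3_le borel_measurable_times borel_measurable_const meas) auto
  also have "Lnorm q (\<lambda>x. r * cvec_norm (P x *\<^sub>v C x)) = ennreal r * Lnorm q (\<lambda>x. cvec_norm (P x *\<^sub>v C x))"
    using q r by (intro Lnorm_cmult meas) auto
  also have "Lnorm q (\<lambda>x. cvec_norm (P x *\<^sub>v ?T g x)) = wnorm q V (?T g)"
    by (simp add: wnorm_weight_root[OF V] P_def)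
  also have "Lnorm q (\<lambda>x. cvec_norm (P x *\<^sub>v C x)) = wnorm q V (commutator m B T k)"
    by (simp add: wnorm_weight_root[OF V] P_def C_def)
  also have "Lnorm q (\<lambda>x. cvec_norm (R x *\<^sub>v ?T k x)) = wnorm q U (?T k)"
    by (simp add: wnorm_weight_root[OF U] R_def)
  also have "9 * (wnorm q V (?T g) + ennreal r * wnorm q V (commutator m B T k) + wnorm q U (?T k)) \<le>
      9 * (?NV + ennreal r * ?NC + ?NU)"
    by (intro mult_left_mono add_mono wnorm_le_op_norm gL gD g1 kL kC kD k1) auto
  finally show "wnorm q ?W (vec_ext (m + m) T f) \<le> 9 * (?NV + ennreal r * ?NC + ?NU)" .
qed

theorem lemma1p3:
  fixes T :: "('a::euclidean_space \<Rightarrow> complex) \<Rightarrow> ('a \<Rightarrow> complex)"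
    and D :: "('a \<Rightarrow> complex) set"
    and \<alpha> p q :: real and m :: nat
  assumes "0 < \<alpha>" and "\<alpha> < real DIM('a)"
    and "1 < p" and "1 < q" and "\<alpha> / real DIM('a) + 1 / q = 1 / p"
    and "fractional_lower_bound_operator p q D T"
    and "1 \<le> m"
  shows "\<exists>C>0. \<forall>U V B. Apq_weight m p q U \<longrightarrow> Apq_weight m p q V \<longrightarrow> locally_integrable_mat m B \<longrightarrow>
    bmo_norm p q V U B \<le>
    ennreal C * op_norm m p (weight_powr U (p/q)) q V (commutator_dom m B D) (commutator m B T)"
proof -
  note flb = assms(6)[unfolded fractional_lower_bound_operator_def]
  have lin: "linear_operator D T" using flb by blast
  have "1 \<le> m + m" using assms(7) by simp
  then obtain c where c: "0 < c" and lower: "\<And>W. matrix_weight (m + m) W \<Longrightarrow>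
      ennreal_rpow (Apq_const p q W) (1/q) \<le>
      ennreal c * op_norm (m + m) p (weight_powr W (p/q)) q W (vec_dom (m + m) D) (vec_ext (m + m) T)"
    using flb by blast
  have upper: "wLp m p (weight_powr W (p/q)) \<subseteq> vec_dom m D"
      "op_norm m p (weight_powr W (p/q)) q W (vec_dom m D) (vec_ext m T) < \<infinity>"
    if "Apq_weight m p q W" for W
    using flb assms(7) that by blast+
  show ?thesis
  \<comment> \<open>The factor \<open>c\<close> is the lower bound constant for size
    \<open>m + m\<close>, fixed before \<open>U\<close>, \<open>V\<close> and \<open>B\<close> are
    given; 9 comes from \<open>op_norm_block_weight_le\<close>.\<close>
  proof (intro exI[of _ "9 * c"] conjI allI impI)
    show "0 < 9 * c" using c by simp
    fix U V B :: "'a \<Rightarrow> complex mat"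
    assume U: "Apq_weight m p q U" and V: "Apq_weight m p q V" and "locally_integrable_mat m B"
    hence B: "measurable_mat m B" by (intro measurable_mat_locally_integrable)
    have Um: "matrix_weight m U" and Vm: "matrix_weight m V" using U V by (auto simp: Apq_weight_def)
    let ?NV = "op_norm m p (weight_powr V (p/q)) q V (vec_dom m D) (vec_ext m T)"
    let ?NU = "op_norm m p (weight_powr U (p/q)) q U (vec_dom m D) (vec_ext m T)"
    let ?NC = "op_norm m p (weight_powr U (p/q)) q V (commutator_dom m B D) (commutator m B T)"
    show "bmo_norm p q V U B \<le> ennreal (9 * c) * ?NC"
    proof (rule ennreal_le_of_scaled_le)
      show "0 < 9 * c" using c by simp
      show "?NV + ?NU < \<infinity>" using upper(2)[OF V] upper(2)[OF U] by simp
      fix r :: real assume r: "0 < r"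
      let ?W = "block_weight m q r V B U"
      have "ennreal r * bmo_norm p q V U B \<le> ennreal_rpow (Apq_const p q ?W) (1/q)"
        by (rule bmo_norm_le_Apq_const_block_weight[OF Vm Um B assms(3,4) r])
      also have "\<dots> \<le> ennreal c *
          op_norm (m + m) p (weight_powr ?W (p/q)) q ?W (vec_dom (m + m) D) (vec_ext (m + m) T)"
        by (intro lower matrix_weight_block_weight Vm Um B)
      also have "\<dots> \<le> ennreal c * (9 * (?NV + ennreal r * ?NC + ?NU))"
        by (intro mult_left_mono op_norm_block_weight_le Vm Um B lin upper(1)[OF V] assms(3,4) r) auto
      also have "\<dots> = ennreal (9 * c) * (?NV + ?NU + ennreal r * ?NC)"
        using c by (simp add: ennreal_mult ac_simps)
      finally show "ennreal r * bmo_norm p q V U B \<le> ennreal (9 * c) * (?NV + ?NU + ennreal r * ?NC)" .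
    qed
  qed
qed

end
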